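(* Let $E$ be a symmetric space on $I$ with fundamental function $\phi$. If $x\in E$ is an LLUKM point of $E$ and $\lim_{t\to0^+}x^*(t)\phi(t)=0$, then $|x|$ is an LLUM point of $E$.
   Context: Let $I=[0,\alpha)$ with $\alpha=1$ or $\alpha=\infty$, with Lebesgue measure $\mu$, and let $L^0$ be the set of (equivalence classes of) extended real valued measurable functions on $I$. A Banach function space $(E,\|\cdot\|_E)$ is a Banach lattice that is a sublattice of $L^0$ such that (1) $x\in L^0$, $y\in E$, $|x|\le|y|$ a.e. imply $x\in E$ and $\|x\|_E\le\|y\|_E$; (2) $E$ contains a strictly positive function. $E^+=\{x\in E:x\ge0\}$. For $x\in L^0$: $d_x(\lambda)=\mu\{s\in I:|x(s)|>\lambda\}$, $x^*(t)=\inf\{\lambda>0:d_x(\lambda)\le t\}$, $x^{**}(t)=\frac1t\int_0^t x^*(s)\,ds$. $E$ is symmetric if $x\in L^0$, $y\in E$, $d_x=d_y$ imply $x\in E$ and $\|x\|_E=\|y\|_E$. Its fundamental function is $\phi(t)=\|\chi_{(0,t)}\|_E$. Standing assumption: $E$ has the Fatou property, i.e. if $(x_n)\subset E^+$, $\sup_n\|x_n\|_E<\infty$ and $x_n\uparrow x\in L^0$, then $x\in E$ and $\|x_n\|_E\uparrow\|x\|_E$. For $x,y\in L^1+L^\infty$, $x\prec y$ means $x^{**}(t)\le y^{**}(t)$ for all $t>0$. $x\in E$ is an LLUKM point (point of lower local uniform $K$-monotonicity) if for every $(x_n)\subset E$ with $x_n\prec x$ for all $n$ and $\|x_n\|_E\to\|x\|_E$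 we have $\|x^*-x_n^*\|_E\to0$. $y\in E^+$ is an LLUM point (point of lower local uniform monotonicity) if for every $(x_n)\subset E^+$ with $x_n\le y$ for all $n$ and $\|x_n\|_E\to\|y\|_E$ we have $\|x_n-y\|_E\to0$. *)

theory Defs
  imports "HOL-Analysis.Analysis"
begin

text \<open>
  Elements of \<open>L\<^sup>0\<close> are represented by Lebesgue measurable functions with values in
  \<^typ>\<open>ereal\<close>; only their values on \<open>[0, \<alpha>)\<close> matter.  Instead of passing to equivalence
  classes, all pointwise relations are required almost everywhere.  A space is given by the set
  \<open>E\<close> of all representatives of its elements together with its norm \<open>N\<close>, whose values outside
  \<open>E\<close> are irrelevant.  The ideal property below makes both \<open>E\<close> and \<open>N\<close> invariant under
  almost everywhere equality.
\<close>

definition dom_I :: "ereal \<Rightarrow> real set" where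
  "dom_I \<alpha> = {s. 0 \<le> s \<and> ereal s < \<alpha>}"

abbreviation leb_I :: "ereal \<Rightarrow> real measure" where
  "leb_I \<alpha> \<equiv> lebesgue_on (dom_I \<alpha>)"

definition L0 :: "ereal \<Rightarrow> (real \<Rightarrow> ereal) set" where
  "L0 \<alpha> = borel_measurable (leb_I \<alpha>)"

definition pos_cone :: "ereal \<Rightarrow> (real \<Rightarrow> ereal) set \<Rightarrow> (real \<Rightarrow> ereal) set" where
  "pos_cone \<alpha> E = {x \<in> E. AE s in leb_I \<alpha>. 0 \<le> x s}"

text \<open>
  The assumption \<open>finite_ae\<close> expresses that the vector space operations of \<open>E\<close> are the
  pointwise ones: it makes sums well defined almost everywhere (on \<^typ>\<open>ereal\<close> the term
  \<open>\<infinity> - \<infinity>\<close> has the arbitrary value \<open>\<infinity>\<close>).  It is no restriction, since \<open>x = \<plusminus>\<infinity>\<close> on a set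
  \<open>A\<close> of positive measure would give \<open>\<infinity>\<cdot>\<chi>\<^sub>A \<in> E\<close> and \<open>2 (\<infinity>\<cdot>\<chi>\<^sub>A) = \<infinity>\<cdot>\<chi>\<^sub>A\<close>.  The lattice
  property of the norm is contained in \<open>ideal\<close>.
\<close>

locale banach_function_space =
  fixes \<alpha> :: ereal and E :: "(real \<Rightarrow> ereal) set" and N :: "(real \<Rightarrow> ereal) \<Rightarrow> real"
  assumes subset_L0: "E \<subseteq> L0 \<alpha>"
    and finite_ae: "x \<in> E \<Longrightarrow> AE s in leb_I \<alpha>. \<bar>x s\<bar> \<noteq> \<infinity>"
    and zero_mem: "(\<lambda>s. 0) \<in> E"
    and add_mem: "x \<in> E \<Longrightarrow> y \<in> E \<Longrightarrow> (\<lambda>s. x s + y s) \<in> E"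
    and scale_mem: "x \<in> E \<Longrightarrow> (\<lambda>s. ereal c * x s) \<in> E"
    and sup_mem: "x \<in> E \<Longrightarrow> y \<in> E \<Longrightarrow> (\<lambda>s. max (x s) (y s)) \<in> E"
    and inf_mem: "x \<in> E \<Longrightarrow> y \<in> E \<Longrightarrow> (\<lambda>s. min (x s) (y s)) \<in> E"
    and norm_nonneg: "x \<in> E \<Longrightarrow> 0 \<le> N x"
    and norm_eq_0_iff: "x \<in> E \<Longrightarrow> N x = 0 \<longleftrightarrow> (AE s in leb_I \<alpha>. x s = 0)"
    and norm_scale: "x \<in> E \<Longrightarrow> N (\<lambda>s. ereal c * x s) = \<bar>c\<bar> * N x"
    and norm_triangle: "x \<in> E \<Longrightarrow> y \<in> E \<Longrightarrow> N (\<lambda>s. x s + y s) \<le> N x + N y"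
    and complete:
      "(\<And>n. X n \<in> E) \<Longrightarrow>
       (\<And>e. 0 < e \<Longrightarrow> \<exists>M. \<forall>m\<ge>M. \<forall>n\<ge>M. N (\<lambda>s. X m s - X n s) < e) \<Longrightarrow>
       \<exists>x\<in>E. (\<lambda>n. N (\<lambda>s. X n s - x s)) \<longlonglongrightarrow> 0"
    and ideal:
      "x \<in> L0 \<alpha> \<Longrightarrow> y \<in> E \<Longrightarrow> (AE s in leb_I \<alpha>. \<bar>x s\<bar> \<le> \<bar>y s\<bar>) \<Longrightarrow> x \<in> E \<and> N x \<le> N y"
    and strictly_positive_elem: "\<exists>w\<in>E. AE s in leb_I \<alpha>. 0 < w s"

definition dist_fun :: "ereal \<Rightarrow> (real \<Rightarrow> ereal) \<Rightarrow> real \<Rightarrow> ennreal" where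
  "dist_fun \<alpha> x r = emeasure (leb_I \<alpha>) {s \<in> dom_I \<alpha>. ereal r < \<bar>x s\<bar>}"

text \<open>
  The decreasing rearrangement \<open>x\<^sup>*\<close>.  It is meant for \<open>t \<ge> 0\<close>, takes the value \<open>\<infinity>\<close> where
  no \<open>r\<close> qualifies, and vanishes for \<open>t \<ge> \<alpha>\<close>.
\<close>

definition rearr :: "ereal \<Rightarrow> (real \<Rightarrow> ereal) \<Rightarrow> real \<Rightarrow> ereal" where
  "rearr \<alpha> x t = Inf {ereal r | r. 0 < r \<and> dist_fun \<alpha> x r \<le> ennreal t}"

definition max_rearr :: "ereal \<Rightarrow> (real \<Rightarrow> ereal) \<Rightarrow> real \<Rightarrow> ennreal" where
  "max_rearr \<alpha> x t =
     ennreal (1 / t) * (\<integral>\<^sup>+ s. e2ennreal (rearr \<alpha> x s) * indicator {0<..<t} s \<partial>lebesgue)"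

locale symmetric_space = banach_function_space +
  assumes symmetric:
    "x \<in> L0 \<alpha> \<Longrightarrow> y \<in> E \<Longrightarrow> dist_fun \<alpha> x = dist_fun \<alpha> y \<Longrightarrow> x \<in> E \<and> N x = N y"

definition fundamental_fun :: "((real \<Rightarrow> ereal) \<Rightarrow> real) \<Rightarrow> real \<Rightarrow> real" where
  "fundamental_fun N t = N (indicator {0<..<t})"

definition fatou_property ::
  "ereal \<Rightarrow> (real \<Rightarrow> ereal) set \<Rightarrow> ((real \<Rightarrow> ereal) \<Rightarrow> real) \<Rightarrow> bool" where
  "fatou_property \<alpha> E N \<longleftrightarrow>
     (\<forall>X x. (\<forall>n. X n \<in> pos_cone \<alpha> E) \<longrightarrow> bdd_above (range (\<lambda>n. N (X n))) \<longrightarrow> x \<in> L0 \<alpha> \<longrightarrow>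
        (AE s in leb_I \<alpha>. incseq (\<lambda>n. X n s) \<and> (\<lambda>n. X n s) \<longlonglongrightarrow> x s) \<longrightarrow>
        x \<in> E \<and> incseq (\<lambda>n. N (X n)) \<and> (\<lambda>n. N (X n)) \<longlonglongrightarrow> N x)"

definition L1_plus_Linf :: "ereal \<Rightarrow> (real \<Rightarrow> ereal) set" where
  "L1_plus_Linf \<alpha> =
     {x \<in> L0 \<alpha>. \<exists>u\<in>L0 \<alpha>. \<exists>v\<in>L0 \<alpha>. \<exists>C::real.
        (\<integral>\<^sup>+ s. e2ennreal \<bar>u s\<bar> \<partial>leb_I \<alpha>) < \<infinity> \<and>
        (AE s in leb_I \<alpha>. \<bar>v s\<bar> \<le> ereal C) \<and>
        (AE s in leb_I \<alpha>. x s = u s + v s)}"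

definition hlp_le :: "ereal \<Rightarrow> (real \<Rightarrow> ereal) \<Rightarrow> (real \<Rightarrow> ereal) \<Rightarrow> bool" where
  "hlp_le \<alpha> x y \<longleftrightarrow>
     x \<in> L1_plus_Linf \<alpha> \<and> y \<in> L1_plus_Linf \<alpha> \<and> (\<forall>t>0. max_rearr \<alpha> x t \<le> max_rearr \<alpha> y t)"

text \<open>
  Rearrangements of elements of \<open>L\<^sup>1 + L\<^sup>\<infinity>\<close> are finite on \<open>(0, \<infinity>)\<close>, so the difference below
  can be of the form \<open>\<infinity> - \<infinity>\<close> only at \<open>t = 0\<close>.
\<close>

definition llukm_point ::
  "ereal \<Rightarrow> (real \<Rightarrow> ereal) set \<Rightarrow> ((real \<Rightarrow> ereal) \<Rightarrow> real) \<Rightarrow> (real \<Rightarrow> ereal) \<Rightarrow> bool" where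
  "llukm_point \<alpha> E N x \<longleftrightarrow> x \<in> E \<and>
     (\<forall>X. (\<forall>n. X n \<in> E) \<longrightarrow> (\<forall>n. hlp_le \<alpha> (X n) x) \<longrightarrow> (\<lambda>n. N (X n)) \<longlonglongrightarrow> N x \<longrightarrow>
        (\<lambda>n. N (\<lambda>t. rearr \<alpha> x t - rearr \<alpha> (X n) t)) \<longlonglongrightarrow> 0)"

definition llum_point ::
  "ereal \<Rightarrow> (real \<Rightarrow> ereal) set \<Rightarrow> ((real \<Rightarrow> ereal) \<Rightarrow> real) \<Rightarrow> (real \<Rightarrow> ereal) \<Rightarrow> bool" where
  "llum_point \<alpha> E N y \<longleftrightarrow> y \<in> pos_cone \<alpha> E \<and>
     (\<forall>X. (\<forall>n. X n \<in> pos_cone \<alpha> E) \<longrightarrow> (\<forall>n. AE s in leb_I \<alpha>. X n s \<le> y s) \<longrightarrow>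
        (\<lambda>n. N (X n)) \<longlonglongrightarrow> N y \<longrightarrow>
        (\<lambda>n. N (\<lambda>s. X n s - y s)) \<longlonglongrightarrow> 0)"

end

theory Submission
  imports Defs
begin

text \<open>
  Write \<open>f = x\<^sup>*\<close>.  By the Fatou property the truncations \<open>f \<chi>\<^bsub>(0,n)\<^esub>\<close> and \<open>min f (f (1/n))\<close> have norms
  tending to that of \<open>x\<close>, so the LLUKM property forces \<open>\<parallel>f \<chi>\<^bsub>(n,\<infinity>)\<^esub>\<parallel> \<rightarrow> 0\<close> and, together with
  \<open>f(t)\<phi>(t) \<rightarrow> 0\<close>, also \<open>\<parallel>f \<chi>\<^bsub>(0,1/n)\<^esub>\<parallel> \<rightarrow> 0\<close>: thus \<open>x\<close> is a point of order continuity.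
  If \<open>0 \<le> x\<^sub>n \<le> |x|\<close> and \<open>\<parallel>x\<^sub>n\<parallel> \<rightarrow> \<parallel>x\<parallel>\<close>, then \<open>x\<^sub>n \<prec> x\<close>, hence \<open>\<parallel>f - x\<^sub>n\<^sup>*\<parallel> \<rightarrow> 0\<close>.  This makes the
  distribution functions of the \<open>x\<^sub>n\<close> converge to that of \<open>x\<close> at every positive level, so \<open>x\<^sub>n \<rightarrow> |x|\<close>
  in measure because \<open>x\<^sub>n \<le> |x|\<close>, and order continuity upgrades this to norm convergence.
  The relation \<open>x\<^sub>n \<prec> x\<close> includes membership in \<open>L\<^sup>1 + L\<^sup>\<infinity>\<close>, which has to be derived: the mean
  of the cyclic rotations of a step function below \<open>f\<close> on \<open>[0, 1)\<close> is constant, which bounds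
  \<open>\<integral>\<^sub>0\<^sup>1 f\<close> by \<open>\<parallel>x\<parallel> / \<phi>(1)\<close>.
\<close>

section \<open>Distribution functions and decreasing rearrangements\<close>

lemma dom_I_measurable [measurable]: "dom_I \<alpha> \<in> sets borel"
  unfolding dom_I_def by measurable

lemma space_leb_I [simp]: "space (leb_I \<alpha>) = dom_I \<alpha>"
  by (simp add: space_restrict_space)

lemma dom_I_lebesgue: "dom_I \<alpha> \<in> sets lebesgue"
  by (simp add: dom_I_measurable)

lemma borel_imp_L0: "f \<in> borel_measurable borel \<Longrightarrow> f \<in> L0 \<alpha>"
  unfolding L0_def by (intro measurable_restrict_space1 measurable_completion) simp

lemma emeasure_leb_I:
  "A \<in> sets lebesgue \<Longrightarrow> A \<subseteq> dom_I \<alpha> \<Longrightarrow> emeasure (leb_I \<alpha>) A = emeasure lebesgue A"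
  by (intro emeasure_restrict_space) (auto simp: dom_I_lebesgue)

lemma emeasure_lborel_Ici: "emeasure lborel {a::real..} = \<infinity>"
proof -
  have "of_nat n \<le> emeasure lborel {a..}" for n
  proof -
    have "ennreal (real n) = emeasure lborel {a..a + real n}"
      by simp
    also have "\<dots> \<le> emeasure lborel {a..}"
      by (intro emeasure_mono) auto
    finally show "of_nat n \<le> emeasure lborel {a..}"
      by (simp add: ennreal_of_nat_eq_real_of_nat)
  qed
  then show ?thesis
    using ennreal_Ex_less_of_nat[of "emeasure lborel {a..}"]
    by (metis infinity_ennreal_def leD top.not_eq_extremum)
qed

lemma sigma_finite_leb_I: "sigma_finite_measure (leb_I \<alpha>)"
proof
  define A where "A n = dom_I \<alpha> \<inter> {..real n}" for n
  have "emeasure (leb_I \<alpha>) (A n) \<noteq> \<infinity>" for n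
  proof -
    have "emeasure (leb_I \<alpha>) (A n) = emeasure lebesgue (A n)"
      unfolding A_def by (intro emeasure_leb_I) (auto simp: dom_I_lebesgue)
    also have "\<dots> \<le> emeasure lebesgue {0..real n}"
      unfolding A_def by (intro emeasure_mono) (auto simp: dom_I_def)
    finally show ?thesis
      by (auto simp: top_unique)
  qed
  moreover have "(\<Union>n. A n) = space (leb_I \<alpha>)"
    using real_arch_simple by (auto simp: A_def)
  moreover have "range A \<subseteq> sets (leb_I \<alpha>)"
    by (auto simp: A_def sets_restrict_space dom_I_lebesgue)
  ultimately show "\<exists>A. countable A \<and> A \<subseteq> sets (leb_I \<alpha>) \<and> \<Union> A = space (leb_I \<alpha>) \<and> (\<forall>a\<in>A. emeasure (leb_I \<alpha>) a \<noteq> \<infinity>)"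
    by (intro exI[of _ "range A"]) auto
qed

text \<open>The superlevel sets of a rearrangement have this shape. The bound on \<open>D\<close>
  keeps the segment inside the domain, so that no length is lost.\<close>

lemma emeasure_initial_segment:
  assumes "D \<le> e2ennreal \<alpha>"
  shows "emeasure (leb_I \<alpha>) {t \<in> dom_I \<alpha>. ennreal t < D} = D"
proof (cases "D = 0")
  case False
  then have "0 < e2ennreal \<alpha>"
    using assms by (metis le_zero_eq not_gr_zero)
  then have pos: "0 < \<alpha>"
    by (metis e2ennreal_neg not_le order_less_irrefl)
  show ?thesis
  proof (cases D)
    case (real d)
    have "ereal d \<le> \<alpha>"
      using assms real pos by (cases \<alpha>) (auto simp: ennreal_le_iff2)
    then have "{t \<in> dom_I \<alpha>. ennreal t < D} = {0..<d}"
      using real by (auto simp: dom_I_def ennreal_less_iff) (metis ereal_less(2) less_le_trans less_ereal.simps(1))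
    moreover have "{0..<d} \<subseteq> dom_I \<alpha>"
      using calculation by blast
    ultimately show ?thesis
      using real by (simp add: emeasure_leb_I)
  next
    case top
    then have "\<alpha> = \<infinity>"
      using assms pos by (cases \<alpha>) (auto simp: top_unique)
    then have "{t \<in> dom_I \<alpha>. ennreal t < D} = {0..}" "{0..} \<subseteq> dom_I \<alpha>"
      using top by (auto simp: dom_I_def)
    then show ?thesis
      using top emeasure_leb_I[of "{0..}" \<alpha>] by (simp add: emeasure_lborel_Ici flip: atLeast_def)
  qed
qed simp

lemma emeasure_dom_I: "emeasure (leb_I \<alpha>) (dom_I \<alpha>) = e2ennreal \<alpha>"
proof (cases \<alpha>)
  case (real a)
  then have "dom_I \<alpha> = {0..<a}" by (auto simp: dom_I_def)
  then show ?thesis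
    using real emeasure_leb_I[of "{0..<a}" \<alpha>] by (cases "0 \<le> a") (auto simp: e2ennreal_neg ennreal_neg)
next
  case PInf
  then have "dom_I \<alpha> = {0..}" by (auto simp: dom_I_def)
  then show ?thesis
    using PInf emeasure_leb_I[of "{0..}" \<alpha>] by (simp add: emeasure_lborel_Ici)
next
  case MInf
  then have "dom_I \<alpha> = {}" by (auto simp: dom_I_def)
  then show ?thesis using MInf by (simp add: e2ennreal_neg)
qed

section \<open>Distribution functions\<close>

lemma level_set_measurable:
  assumes "x \<in> L0 \<alpha>"
  shows "{s \<in> dom_I \<alpha>. ereal r < \<bar>x s\<bar>} \<in> sets (leb_I \<alpha>)"
proof -
  have [measurable]: "x \<in> borel_measurable (leb_I \<alpha>)"
    using assms by (simp add: L0_def)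
  have "{s \<in> space (leb_I \<alpha>). ereal r < \<bar>x s\<bar>} \<in> sets (leb_I \<alpha>)"
    by measurable
  then show ?thesis by simp
qed

lemma dist_fun_antimono:
  assumes "x \<in> L0 \<alpha>" "r \<le> r'"
  shows "dist_fun \<alpha> x r' \<le> dist_fun \<alpha> x r"
  unfolding dist_fun_def
proof (rule emeasure_mono)
  have "ereal r \<le> ereal r'"
    using assms by simp
  then show "{s \<in> dom_I \<alpha>. ereal r' < \<bar>x s\<bar>} \<subseteq> {s \<in> dom_I \<alpha>. ereal r < \<bar>x s\<bar>}"
    using le_less_trans by blast
qed (rule level_set_measurable[OF assms(1)])

lemma dist_fun_le: "dist_fun \<alpha> x r \<le> e2ennreal \<alpha>"
proof -
  have "dist_fun \<alpha> x r \<le> emeasure (leb_I \<alpha>) (space (leb_I \<alpha>))"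
    unfolding dist_fun_def by (rule emeasure_space)
  then show ?thesis by (simp add: emeasure_dom_I)
qed

lemma dist_fun_neg:
  assumes "r < 0"
  shows "dist_fun \<alpha> x r = e2ennreal \<alpha>"
proof -
  have "{s \<in> dom_I \<alpha>. ereal r < \<bar>x s\<bar>} = dom_I \<alpha>"
    using assms by (auto intro: less_le_trans[of _ 0])
  then show ?thesis by (simp add: dist_fun_def emeasure_dom_I)
qed

lemma dist_fun_mono:
  assumes "y \<in> L0 \<alpha>" "AE s in leb_I \<alpha>. \<bar>x s\<bar> \<le> \<bar>y s\<bar>"
  shows "dist_fun \<alpha> x r \<le> dist_fun \<alpha> y r"
  unfolding dist_fun_def
proof (rule emeasure_mono_AE)
  show "AE s in leb_I \<alpha>. s \<in> {s \<in> dom_I \<alpha>. ereal r < \<bar>x s\<bar>} \<longrightarrow> s \<in> {s \<in> dom_I \<alpha>. ereal r < \<bar>y s\<bar>}"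
    using assms(2) by eventually_elim (use less_le_trans in blast)
qed (rule level_set_measurable[OF assms(1)])

text \<open>The level set at \<open>r\<close> is the increasing union of those at
  \<open>r + 1/(k+1)\<close>, so continuity of the measure from below applies.\<close>

lemma dist_fun_right_continuous:
  assumes x: "x \<in> L0 \<alpha>" and t: "D < dist_fun \<alpha> x r"
  shows "\<exists>r'>r. D < dist_fun \<alpha> x r'"
proof -
  define A where "A k = {s \<in> dom_I \<alpha>. ereal (r + 1 / real (Suc k)) < \<bar>x s\<bar>}" for k
  have "(\<Union>k. A k) = {s \<in> dom_I \<alpha>. ereal r < \<bar>x s\<bar>}"
  proof (intro set_eqI iffI)
    fix s assume "s \<in> {s \<in> dom_I \<alpha>. ereal r < \<bar>x s\<bar>}"
    then have s: "s \<in> dom_I \<alpha>" "ereal r < \<bar>x s\<bar>" by auto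
    then obtain q where q: "r < q" "ereal q < \<bar>x s\<bar>"
      using ereal_dense2 by force
    obtain k where "1 / real (Suc k) < q - r"
      using q nat_approx_posE[of "q - r"] by auto
    then have "ereal (r + 1 / real (Suc k)) \<le> ereal q"
      by simp
    then have "ereal (r + 1 / real (Suc k)) < \<bar>x s\<bar>"
      using q(2) by (rule le_less_trans)
    then show "s \<in> (\<Union>k. A k)"
      using s unfolding A_def by blast
  next
    fix s assume "s \<in> (\<Union>k. A k)"
    then obtain k where k: "s \<in> dom_I \<alpha>" "ereal (r + 1 / real (Suc k)) < \<bar>x s\<bar>"
      unfolding A_def by blast
    have "ereal r \<le> ereal (r + 1 / real (Suc k))" by simp
    then show "s \<in> {s \<in> dom_I \<alpha>. ereal r < \<bar>x s\<bar>}"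
      using k le_less_trans by blast
  qed
  moreover have "incseq A"
  proof (rule incseq_SucI, rule subsetI)
    fix k s assume "s \<in> A k"
    moreover have "ereal (r + 1 / real (Suc (Suc k))) \<le> ereal (r + 1 / real (Suc k))"
      by (simp add: frac_le)
    ultimately show "s \<in> A (Suc k)"
      unfolding A_def using le_less_trans by blast
  qed
  moreover have "range A \<subseteq> sets (leb_I \<alpha>)"
    unfolding A_def using level_set_measurable[OF x] by blast
  ultimately have "(SUP k. emeasure (leb_I \<alpha>) (A k)) = dist_fun \<alpha> x r"
    unfolding dist_fun_def by (simp add: SUP_emeasure_incseq)
  then obtain k where "D < emeasure (leb_I \<alpha>) (A k)"
    using t by (metis less_SUP_iff)
  then show ?thesis
    unfolding A_def dist_fun_def[symmetric] by (intro exI[of _ "r + 1 / real (Suc k)"]) simp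
qed

section \<open>The decreasing rearrangement and its duality with the distribution function\<close>

lemma rearr_nonneg [simp]: "0 \<le> rearr \<alpha> x t"
  unfolding rearr_def by (intro Inf_greatest) auto

lemma rearr_abs [simp]: "\<bar>rearr \<alpha> x t\<bar> = rearr \<alpha> x t"
  by simp

text \<open>This duality reduces questions about rearrangements to distribution functions. Right
  continuity makes it exact with strict inequalities on both sides.\<close>

lemma less_rearr_iff:
  assumes x: "x \<in> L0 \<alpha>" and "0 \<le> r"
  shows "ereal r < rearr \<alpha> x t \<longleftrightarrow> ennreal t < dist_fun \<alpha> x r"
proof
  assume l: "ereal r < rearr \<alpha> x t"
  show "ennreal t < dist_fun \<alpha> x r"
  proof (rule ccontr)
    assume n: "\<not> ?thesis"
    \<comment> \<open>The infimum in \<open>rearr\<close> admits positive levels only;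
      \<open>q\<close> is positive even when \<open>r = 0\<close>.\<close>
    obtain q where q: "r < q" "ereal q < rearr \<alpha> x t"
      using l ereal_dense2 by force
    have "dist_fun \<alpha> x q \<le> ennreal t"
      using n dist_fun_antimono[OF x, of r q] q by simp
    then have "rearr \<alpha> x t \<le> ereal q"
      unfolding rearr_def using q \<open>0 \<le> r\<close> by (intro Inf_lower) auto
    then show False using q by simp
  qed
next
  assume "ennreal t < dist_fun \<alpha> x r"
  then obtain q where q: "r < q" "ennreal t < dist_fun \<alpha> x q"
    using dist_fun_right_continuous[OF x] by blast
  have "ereal q \<le> rearr \<alpha> x t"
    unfolding rearr_def
  proof (intro Inf_greatest, clarify)
    fix p assume "0 < p" "dist_fun \<alpha> x p \<le> ennreal t"
    then have "\<not> p \<le> q"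
      using dist_fun_antimono[OF x, of p q] q by (metis leD le_less_trans less_le_trans)
    then show "ereal q \<le> ereal p" by simp
  qed
  then show "ereal r < rearr \<alpha> x t"
    using q by (meson less_ereal.simps(1) less_le_trans)
qed

lemma rearr_le_iff:
  assumes "x \<in> L0 \<alpha>" "0 \<le> r"
  shows "rearr \<alpha> x t \<le> ereal r \<longleftrightarrow> dist_fun \<alpha> x r \<le> ennreal t"
  using less_rearr_iff[OF assms, of t] by (metis not_le)

lemma rearr_antimono: "t \<le> t' \<Longrightarrow> rearr \<alpha> x t' \<le> rearr \<alpha> x t"
  unfolding rearr_def by (intro Inf_superset_mono) (auto intro: order_trans[OF _ ennreal_leI])

lemma rearr_mono:
  assumes "\<And>r. 0 < r \<Longrightarrow> dist_fun \<alpha> x r \<le> dist_fun \<alpha> y r"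
  shows "rearr \<alpha> x t \<le> rearr \<alpha> y t"
  unfolding rearr_def by (intro Inf_superset_mono) (auto intro: order_trans[OF assms])

lemma rearr_borel: 
  assumes "x \<in> L0 \<alpha>"
  shows "rearr \<alpha> x \<in> borel_measurable borel"
proof (rule borel_measurableI_greater)
  fix c :: ereal
  have "{t. c < rearr \<alpha> x t} \<in> sets borel"
  proof (cases c)
    case (real r)
    show ?thesis
    proof (cases "0 \<le> r")
      case True
      then show ?thesis
        using real by (simp add: less_rearr_iff[OF assms])
    next
      case False
      then have "{t. c < rearr \<alpha> x t} = UNIV"
        using real by (auto intro: less_le_trans[of _ 0])
      then show ?thesis by simp
    qed
  next
    case MInf
    then have "{t. c < rearr \<alpha> x t} = UNIV"
      by (auto intro: less_le_trans[of _ 0])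
    then show ?thesis by simp
  qed auto
  then show "{t \<in> space borel. c < rearr \<alpha> x t} \<in> sets borel" by simp
qed

lemma rearr_L0: "x \<in> L0 \<alpha> \<Longrightarrow> rearr \<alpha> x \<in> L0 \<alpha>"
  using borel_imp_L0 rearr_borel by blast

text \<open>By duality, the level set of the rearrangement at \<open>r \<ge> 0\<close> is the
  initial segment of length \<open>dist_fun \<alpha> x r\<close>. At negative levels both sides are
  the measure of the whole domain.\<close>

lemma dist_fun_rearr:
  assumes "x \<in> L0 \<alpha>"
  shows "dist_fun \<alpha> (rearr \<alpha> x) = dist_fun \<alpha> x"
proof
  fix r
  show "dist_fun \<alpha> (rearr \<alpha> x) r = dist_fun \<alpha> x r"
  proof (cases "0 \<le> r")
    case True
    then show ?thesis
      unfolding dist_fun_def[of _ "rearr \<alpha> x"]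
      by (simp add: less_rearr_iff[OF assms] emeasure_initial_segment dist_fun_le)
  qed (simp add: dist_fun_neg)
qed

text \<open>Meant for functions supported on a set of measure at most \<open>t\<close>.\<close>

lemma rearr_supp:
  assumes "\<And>r. 0 < r \<Longrightarrow> dist_fun \<alpha> x r \<le> ennreal t"
  shows "rearr \<alpha> x t = 0"
proof -
  have "rearr \<alpha> x t \<le> ereal e" if "0 < e" for e
    unfolding rearr_def using that assms by (intro Inf_lower) auto
  then have "rearr \<alpha> x t \<le> 0"
    by (metis ereal_dense2 ereal_less(2) leD not_less)
  then show ?thesis by (simp add: antisym)
qed

text \<open>At \<open>t = 0\<close> a rearrangement may be infinite; pointwise estimates can
  therefore be restricted to \<open>t > 0\<close>.\<close>

lemma AE_leb_I_pos: "AE t in leb_I \<alpha>. 0 < t"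
proof -
  have "AE t in lebesgue. t \<noteq> (0::real)"
    by (rule AE_not_in[of "{0::real}", simplified])  (auto simp: null_sets_def)
  then have "AE t in leb_I \<alpha>. t \<noteq> 0"
    by (simp add: AE_restrict_space_iff dom_I_lebesgue eventually_mono)
  then show ?thesis
    by (auto simp: dom_I_def AE_restrict_space_iff dom_I_lebesgue elim: eventually_mono)
qed

lemma AE_leb_I_of_pos: "(\<And>t. 0 < t \<Longrightarrow> P t) \<Longrightarrow> AE t in leb_I \<alpha>. P t"
  using AE_leb_I_pos by (rule eventually_mono)

text \<open>Layer-cake formula: Tonelli for the region \<open>0 \<le> r < \<bar>x s\<bar>\<close>.
  It shows that equimeasurable functions have the same integral of absolute values.\<close>

lemma nn_integral_abs_eq_dist_fun:
  assumes "x \<in> L0 \<alpha>"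
  shows "(\<integral>\<^sup>+ s. e2ennreal \<bar>x s\<bar> \<partial>leb_I \<alpha>) = (\<integral>\<^sup>+ r. dist_fun \<alpha> x r * indicator {0..} r \<partial>lborel)"
proof -
  interpret L: sigma_finite_measure "leb_I \<alpha>"
    by (rule sigma_finite_leb_I)
  interpret P: pair_sigma_finite "leb_I \<alpha>" lborel ..
  have [measurable]: "x \<in> borel_measurable (leb_I \<alpha>)"
    using assms by (simp add: L0_def)
  let ?h = "\<lambda>s r. indicator {(s, r). ereal r < \<bar>x s\<bar> \<and> 0 \<le> r} (s, r) :: ennreal"
  have 1: "(\<integral>\<^sup>+ r. ?h s r \<partial>lborel) = e2ennreal \<bar>x s\<bar>" for s
  proof -
    have "(\<integral>\<^sup>+ r. ?h s r \<partial>lborel) = (\<integral>\<^sup>+ r. indicator {r. ereal r < \<bar>x s\<bar> \<and> 0 \<le> r} r \<partial>lborel)"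
      by (intro nn_integral_cong) (auto simp: indicator_def)
    also have "\<dots> = emeasure lborel {r. ereal r < \<bar>x s\<bar> \<and> 0 \<le> r}"
      by (intro nn_integral_indicator) simp
    also have "\<dots> = e2ennreal \<bar>x s\<bar>"
    proof (cases "\<bar>x s\<bar>")
      case (real a)
      then have "{r. ereal r < \<bar>x s\<bar> \<and> 0 \<le> r} = {0..<a}" "0 \<le> a"
        using abs_ereal_pos[of "x s"] by auto
      then show ?thesis using real by simp
    next
      case PInf
      then have "{r. ereal r < \<bar>x s\<bar> \<and> 0 \<le> r} = {0..}" by auto
      then show ?thesis using PInf by (simp add: emeasure_lborel_Ici)
    qed (use abs_ereal_pos[of "x s"] in auto)
    finally show ?thesis .
  qed
  have 2: "(\<integral>\<^sup>+ s. ?h s r \<partial>leb_I \<alpha>) = dist_fun \<alpha> x r * indicator {0..} r" for r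
  proof -
    have "(\<integral>\<^sup>+ s. ?h s r \<partial>leb_I \<alpha>)
        = (\<integral>\<^sup>+ s. indicator {0..} r * indicator {s \<in> dom_I \<alpha>. ereal r < \<bar>x s\<bar>} s \<partial>leb_I \<alpha>)"
      by (intro nn_integral_cong) (auto simp: indicator_def)
    also have "\<dots> = indicator {0..} r * dist_fun \<alpha> x r"
      unfolding dist_fun_def using level_set_measurable[OF assms]
      by (subst nn_integral_cmult) (auto simp: nn_integral_indicator)
    finally show ?thesis by (simp add: mult.commute)
  qed
  have "(\<integral>\<^sup>+ s. (\<integral>\<^sup>+ r. ?h s r \<partial>lborel) \<partial>leb_I \<alpha>) = (\<integral>\<^sup>+ r. (\<integral>\<^sup>+ s. ?h s r \<partial>leb_I \<alpha>) \<partial>lborel)"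
  proof (intro P.Fubini'[symmetric])
    have "{p \<in> space (leb_I \<alpha> \<Otimes>\<^sub>M lborel). ereal (snd p) < \<bar>x (fst p)\<bar> \<and> 0 \<le> snd p} \<in> sets (leb_I \<alpha> \<Otimes>\<^sub>M lborel)"
    proof -
      have [measurable]: "(\<lambda>p. x (fst p)) \<in> borel_measurable (leb_I \<alpha> \<Otimes>\<^sub>M lborel)"
        by measurable
      have [measurable]: "(\<lambda>p. ereal (snd p)) \<in> borel_measurable (leb_I \<alpha> \<Otimes>\<^sub>M (lborel :: real measure))"
        by measurable
      show ?thesis
        by measurable
    qed
    then have "(indicator {p \<in> space (leb_I \<alpha> \<Otimes>\<^sub>M lborel). ereal (snd p) < \<bar>x (fst p)\<bar> \<and> 0 \<le> snd p} :: _ \<Rightarrow> ennreal)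
        \<in> borel_measurable (leb_I \<alpha> \<Otimes>\<^sub>M lborel)"
      by (rule borel_measurable_indicator)
    then show "case_prod ?h \<in> borel_measurable (leb_I \<alpha> \<Otimes>\<^sub>M lborel)"
      by (rule measurable_cong[THEN iffD1, rotated]) (auto simp: indicator_def)
  qed
  then show ?thesis unfolding 1 2 .
qed

section \<open>Symmetric spaces embed into \<open>L\<^sup>1 + L\<^sup>\<infinity>\<close>\<close>

text \<open>Treats \<open>\<alpha> = 1\<close> and \<open>\<alpha> = \<infinity>\<close> at once: in
  both cases \<open>[0, 1)\<close> lies in the domain.\<close>

locale symmetric_space_ge1 = symmetric_space +
  assumes one_le: "1 \<le> \<alpha>"
begin

lemma mem_dom_I: "0 \<le> t \<Longrightarrow> t < 1 \<Longrightarrow> t \<in> dom_I \<alpha>"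
  using one_le unfolding dom_I_def by (auto simp: one_ereal_def elim!: less_le_trans[rotated])

lemma mem_L0: "x \<in> E \<Longrightarrow> x \<in> L0 \<alpha>"
  using subset_L0 by blast

lemma mem_mono: "x \<in> L0 \<alpha> \<Longrightarrow> y \<in> E \<Longrightarrow> (AE s in leb_I \<alpha>. \<bar>x s\<bar> \<le> \<bar>y s\<bar>) \<Longrightarrow> x \<in> E"
  and norm_mono: "x \<in> L0 \<alpha> \<Longrightarrow> y \<in> E \<Longrightarrow> (AE s in leb_I \<alpha>. \<bar>x s\<bar> \<le> \<bar>y s\<bar>) \<Longrightarrow> N x \<le> N y"
  using ideal by blast+

lemma abs_L0: "x \<in> L0 \<alpha> \<Longrightarrow> (\<lambda>s. \<bar>x s\<bar>) \<in> L0 \<alpha>"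
  unfolding L0_def by measurable

lemma abs_mem: "x \<in> E \<Longrightarrow> (\<lambda>s. \<bar>x s\<bar>) \<in> E"
  by (rule mem_mono[of _ x]) (auto intro: abs_L0 mem_L0)

lemma norm_abs: "x \<in> E \<Longrightarrow> N (\<lambda>s. \<bar>x s\<bar>) = N x"
  by (intro antisym norm_mono) (auto intro: abs_L0 mem_L0 abs_mem)

text \<open>Ideal property and triangle inequality combined. With absolute values on the right, no
  undefined difference of infinities can occur.\<close>

lemma dominated_by_sum:
  assumes "z \<in> L0 \<alpha>" "u \<in> E" "v \<in> E" "AE s in leb_I \<alpha>. \<bar>z s\<bar> \<le> \<bar>u s\<bar> + \<bar>v s\<bar>"
  shows "z \<in> E" "N z \<le> N u + N v"
proof -
  have w: "(\<lambda>s. \<bar>u s\<bar> + \<bar>v s\<bar>) \<in> E"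
    using assms by (intro add_mem abs_mem)
  have ae: "AE s in leb_I \<alpha>. \<bar>z s\<bar> \<le> \<bar>\<bar>u s\<bar> + \<bar>v s\<bar>\<bar>"
    using assms(4) by (auto elim!: eventually_mono simp: abs_ereal_ge0)
  show "z \<in> E"
    using mem_mono[OF assms(1) w ae] .
  have "N z \<le> N (\<lambda>s. \<bar>u s\<bar> + \<bar>v s\<bar>)"
    using norm_mono[OF assms(1) w ae] .
  also have "\<dots> \<le> N u + N v"
    using norm_triangle[OF abs_mem[OF assms(2)] abs_mem[OF assms(3)]] assms by (simp add: norm_abs)
  finally show "N z \<le> N u + N v" .
qed

lemma sum_mem_norm:
  assumes "finite K" "\<And>k. k \<in> K \<Longrightarrow> g k \<in> E"
  shows "(\<lambda>s. \<Sum>k\<in>K. g k s) \<in> E \<and> N (\<lambda>s. \<Sum>k\<in>K. g k s) \<le> (\<Sum>k\<in>K. N (g k))"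
  using assms
proof (induction K rule: finite_induct)
  case empty
  then show ?case using zero_mem norm_eq_0_iff[OF zero_mem] by simp
next
  case (insert k K)
  then have "(\<lambda>s. \<Sum>k\<in>K. g k s) \<in> E \<and> N (\<lambda>s. \<Sum>k\<in>K. g k s) \<le> (\<Sum>k\<in>K. N (g k))" "g k \<in> E"
    by auto
  then show ?case
    using add_mem[of "g k" "\<lambda>s. \<Sum>k\<in>K. g k s"] norm_triangle[of "g k" "\<lambda>s. \<Sum>k\<in>K. g k s"] insert.hyps
    by auto
qed

lemma rearr_mem: "x \<in> E \<Longrightarrow> rearr \<alpha> x \<in> E"
  and norm_rearr: "x \<in> E \<Longrightarrow> N (rearr \<alpha> x) = N x"
  using symmetric rearr_L0 mem_L0 dist_fun_rearr by blast+

text \<open>The symmetry axiom speaks of equal distribution functions only. For an inequality, the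
  two rearrangements are compared pointwise by the ideal property, and symmetry leads back to
  \<open>x\<close> and \<open>y\<close>.\<close>

lemma dist_mono:
  assumes "x \<in> L0 \<alpha>" "y \<in> E" "\<And>r. 0 < r \<Longrightarrow> dist_fun \<alpha> x r \<le> dist_fun \<alpha> y r"
  shows "x \<in> E" "N x \<le> N y"
proof -
  have ae: "AE s in leb_I \<alpha>. \<bar>rearr \<alpha> x s\<bar> \<le> \<bar>rearr \<alpha> y s\<bar>"
    using rearr_mono[OF assms(3)] by simp
  have "rearr \<alpha> x \<in> E" "N (rearr \<alpha> x) \<le> N (rearr \<alpha> y)"
    using ideal[OF rearr_L0[OF assms(1)] rearr_mem[OF assms(2)] ae] by auto
  moreover have "dist_fun \<alpha> x = dist_fun \<alpha> (rearr \<alpha> x)"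
    by (simp add: dist_fun_rearr assms)
  ultimately show "x \<in> E" "N x \<le> N y"
    using symmetric[OF assms(1), of "rearr \<alpha> x"] norm_rearr[OF assms(2)] by auto
qed

text \<open>The majorant \<open>y\<close> need not be decreasing, which allows explicit bounds on
  rearrangements to be turned into norm bounds.\<close>

lemma rearr_norm_mono:
  assumes "x \<in> L0 \<alpha>" "y \<in> E" "AE t in leb_I \<alpha>. rearr \<alpha> x t \<le> \<bar>y t\<bar>"
  shows "x \<in> E" "N x \<le> N y"
proof -
  have "dist_fun \<alpha> x r \<le> dist_fun \<alpha> y r" for r
    using dist_fun_mono[OF mem_L0[OF assms(2)], of "rearr \<alpha> x" r] assms by (simp add: dist_fun_rearr)
  then show "x \<in> E" "N x \<le> N y"
    using dist_mono[OF assms(1,2)] by auto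
qed

section \<open>Indicators of intervals and finiteness of rearrangements\<close>

lemma dist_fun_indicator:
  assumes "0 < r"
  shows "dist_fun \<alpha> (indicator A) r = (if r < 1 then emeasure (leb_I \<alpha>) (dom_I \<alpha> \<inter> A) else 0)"
proof -
  have "{s \<in> dom_I \<alpha>. ereal r < \<bar>indicator A s\<bar>} = (if r < 1 then dom_I \<alpha> \<inter> A else {})"
    using assms by (auto simp: indicator_def one_ereal_def)
  then show ?thesis by (simp add: dist_fun_def)
qed

lemma indicator_L0: "A \<in> sets lebesgue \<Longrightarrow> (indicator A :: real \<Rightarrow> ereal) \<in> L0 \<alpha>"
  unfolding L0_def by (intro measurable_restrict_space1 borel_measurable_indicator)

lemma norm_indicator_ge:
  assumes "A \<in> sets lebesgue" "A \<subseteq> dom_I \<alpha>" "indicator A \<in> E" "ennreal T \<le> emeasure lebesgue A"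
  shows "(indicator {0..<T} :: real \<Rightarrow> ereal) \<in> E" "N (indicator {0..<T}) \<le> N (indicator A)"
proof -
  have "emeasure (leb_I \<alpha>) (dom_I \<alpha> \<inter> {0..<T}) = emeasure lebesgue (dom_I \<alpha> \<inter> {0..<T})"
    by (intro emeasure_leb_I) (auto simp: dom_I_lebesgue)
  also have "\<dots> \<le> emeasure lebesgue {0..<T}"
    by (intro emeasure_mono) auto
  also have "\<dots> = ennreal T"
    by (cases "0 \<le> T") (auto simp: ennreal_neg)
  also have "\<dots> \<le> emeasure (leb_I \<alpha>) (dom_I \<alpha> \<inter> A)"
    using assms by (simp add: emeasure_leb_I Int_absorb1)
  finally have "dist_fun \<alpha> (indicator {0..<T}) r \<le> dist_fun \<alpha> (indicator A) r" if "0 < r" for r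
    using that by (auto simp: dist_fun_indicator)
  then show "(indicator {0..<T} :: real \<Rightarrow> ereal) \<in> E" "N (indicator {0..<T}) \<le> N (indicator A)"
    using dist_mono[OF indicator_L0 assms(3), of "{0..<T}"] by auto
qed

lemma AE_not_in_imp_null:
  assumes "AE s in leb_I \<alpha>. s \<notin> A" "A \<in> sets lebesgue" "A \<subseteq> dom_I \<alpha>"
  shows "emeasure lebesgue A = 0"
proof -
  have "A \<in> sets (leb_I \<alpha>)"
    using assms by (auto simp: sets_restrict_space dom_I_lebesgue)
  then have "emeasure (leb_I \<alpha>) A = 0"
    using assms(1) AE_iff_measurable[of A "leb_I \<alpha>" "\<lambda>s. s \<notin> A"] assms(3) by auto
  then show ?thesis
    using assms by (simp add: emeasure_leb_I)
qed

lemma interval_pos: "\<not> (AE s in leb_I \<alpha>. \<not> (0 < s \<and> s < t))" if "0 < t" "t \<le> 1"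
proof
  assume "AE s in leb_I \<alpha>. \<not> (0 < s \<and> s < t)"
  then have "emeasure lebesgue {0<..<t} = 0"
    using that mem_dom_I by (intro AE_not_in_imp_null) auto
  then show False using that by simp
qed

text \<open>An infinite value at \<open>t\<close> would force the value \<open>\<infinity>\<close>
  on all of \<open>(0, t)\<close>, although the rearrangement belongs to \<open>E\<close> and is
  finite a.e.\<close>

lemma rearr_finite:
  assumes "x \<in> E" "0 < t"
  shows "rearr \<alpha> x t \<noteq> \<infinity>"
proof
  assume inf: "rearr \<alpha> x t = \<infinity>"
  have "AE s in leb_I \<alpha>. \<bar>rearr \<alpha> x s\<bar> \<noteq> \<infinity>"
    using finite_ae[OF rearr_mem[OF assms(1)]] .
  then have "AE s in leb_I \<alpha>. \<not> (0 < s \<and> s < min t 1)"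
  proof eventually_elim
    case (elim s)
    then show ?case
      using rearr_antimono[of s t \<alpha> x] inf by auto
  qed
  then show False
    using interval_pos[of "min t 1"] assms by auto
qed

text \<open>The rearrangement of a strictly positive element exceeds some \<open>r > 0\<close> on
  some \<open>[0, t)\<close>, so the indicator of \<open>[0, t)\<close> is in \<open>E\<close>.
  Finitely many translates of \<open>[0, t)\<close> cover \<open>[0, T)\<close>.\<close>

lemma indicator_mem: "(indicator {0..<T} :: real \<Rightarrow> ereal) \<in> E"
proof -
  obtain w where w: "w \<in> E" "AE s in leb_I \<alpha>. 0 < w s"
    using strictly_positive_elem by blast
  \<comment> \<open>Otherwise the rearrangement of \<open>w\<close> vanishes, hence so do
    \<open>N w\<close> and, a.e., \<open>w\<close>.\<close>
  have "\<exists>r>0. 0 < dist_fun \<alpha> w r"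
  proof (rule ccontr)
    assume "\<not> ?thesis"
    then have "rearr \<alpha> w t = 0" for t
      by (intro rearr_supp) (metis not_gr_zero zero_le)
    then have "N w = 0"
      using norm_rearr[OF w(1)] norm_eq_0_iff[OF rearr_mem[OF w(1)]] by simp
    then have "AE s in leb_I \<alpha>. w s = 0"
      using norm_eq_0_iff[OF w(1)] by simp
    with w(2) have "AE s in leb_I \<alpha>. \<not> (0 < s \<and> s < 1)"
      by eventually_elim simp
    then show False using interval_pos[of 1] by simp
  qed
  then obtain r where r: "0 < r" "0 < dist_fun \<alpha> w r" by blast
  then obtain t where t: "0 < t" "t \<le> 1" "ennreal t < dist_fun \<alpha> w r"
  proof (cases "dist_fun \<alpha> w r")
    case (real d)
    then show ?thesis using that[of "min 1 (d / 2)"] r by (auto simp: ennreal_less_iff)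
  next
    case top
    then show ?thesis using that[of 1] by simp
  qed
  have gt: "ereal r < rearr \<alpha> w s" if "s \<le> t" for s
    using rearr_antimono[OF that, of \<alpha> w] less_rearr_iff[OF mem_L0[OF w(1)], of r t] r t by auto
  have unit: "(indicator {0..<t} :: real \<Rightarrow> ereal) \<in> E"
  proof (rule mem_mono[of _ "\<lambda>s. ereal (1 / r) * rearr \<alpha> w s"])
    show "(\<lambda>s. ereal (1 / r) * rearr \<alpha> w s) \<in> E"
      using scale_mem rearr_mem w by blast
    have "\<bar>indicator {0..<t} s\<bar> \<le> \<bar>ereal (1 / r) * rearr \<alpha> w s\<bar>" for s
    proof (cases "s \<in> {0..<t}")
      case True
      have "1 = ereal (1 / r) * ereal r"
        using r by (simp add: one_ereal_def)
      also have "\<dots> \<le> ereal (1 / r) * rearr \<alpha> w s"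
        using gt[of s] True r by (intro ereal_mult_left_mono) auto
      finally have "1 \<le> ereal (1 / r) * rearr \<alpha> w s" .
      moreover from this have "0 \<le> ereal (1 / r) * rearr \<alpha> w s"
        by (rule order_trans[rotated]) simp
      ultimately show ?thesis
        using True by (simp only: abs_ereal_ge0) simp
    qed simp
    then show "AE s in leb_I \<alpha>. \<bar>indicator {0..<t} s\<bar> \<le> \<bar>ereal (1 / r) * rearr \<alpha> w s\<bar>"
      by simp
  qed (simp add: indicator_L0)
  have step: "(indicator {0..<real n * t} :: real \<Rightarrow> ereal) \<in> E" for n
  proof (induction n)
    case 0
    then show ?case using zero_mem by (simp add: indicator_def)
  next
    case (Suc n)
    let ?J = "{real n * t..<real (Suc n) * t}"
    have J: "(indicator ?J :: real \<Rightarrow> ereal) \<in> E"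
    proof (rule dist_mono(1)[OF _ unit])
      \<comment> \<open>For finite \<open>\<alpha>\<close> the cell may leave the domain, so only an
        inequality with the measure of \<open>[0, t)\<close> is available; \<open>dist_mono\<close>
        accepts it.\<close>
      have "emeasure (leb_I \<alpha>) (dom_I \<alpha> \<inter> ?J) = emeasure lebesgue (dom_I \<alpha> \<inter> ?J)"
        by (intro emeasure_leb_I) (auto simp: dom_I_lebesgue)
      also have "\<dots> \<le> emeasure lebesgue ?J"
        by (intro emeasure_mono) auto
      also have "\<dots> = ennreal t"
        using t by (simp add: algebra_simps)
      also have "\<dots> = emeasure (leb_I \<alpha>) (dom_I \<alpha> \<inter> {0..<t})"
        using t mem_dom_I emeasure_leb_I[of "{0..<t}" \<alpha>] by (simp add: subset_iff Int_absorb1)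
      finally show "dist_fun \<alpha> (indicator ?J) r \<le> dist_fun \<alpha> (indicator {0..<t}) r" if "0 < r" for r
        using that by (auto simp: dist_fun_indicator)
    qed (simp add: indicator_L0)
    show ?case
      by (rule dominated_by_sum(1)[OF indicator_L0 Suc.IH J]) (auto simp: indicator_def)
  qed
  obtain n where "T < real n * t"
    using reals_Archimedean3[OF t(1)] by blast
  then show ?thesis
    by (intro mem_mono[OF indicator_L0 step[of n]]) (auto simp: indicator_def)
qed

lemma norm_indicator_pos:
  assumes "0 < T"
  shows "0 < N (indicator {0..<T})"
proof -
  have "\<not> (AE s in leb_I \<alpha>. (indicator {0..<T} s :: ereal) = 0)"
  proof
    assume "AE s in leb_I \<alpha>. (indicator {0..<T} s :: ereal) = 0"
    then have "AE s in leb_I \<alpha>. \<not> (0 < s \<and> s < min T 1)"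
      by eventually_elim (auto simp: indicator_def)
    then show False using interval_pos[of "min T 1"] assms by auto
  qed
  then show ?thesis
    using norm_nonneg[OF indicator_mem] norm_eq_0_iff[OF indicator_mem, of T] by (simp add: less_le)
qed

lemma fundamental_fun_eq: "fundamental_fun N t = N (indicator {0..<t})"
proof -
  have 1: "AE s in leb_I \<alpha>. \<bar>indicator {0<..<t} s\<bar> \<le> \<bar>indicator {0..<t} s :: ereal\<bar>"
    by (auto simp: indicator_def)
  have 2: "AE s in leb_I \<alpha>. \<bar>indicator {0..<t} s\<bar> \<le> \<bar>indicator {0<..<t} s :: ereal\<bar>"
    using AE_leb_I_pos by eventually_elim (auto simp: indicator_def)
  have "(indicator {0<..<t} :: real \<Rightarrow> ereal) \<in> E"
    using mem_mono[OF indicator_L0 indicator_mem 1] by simp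
  then show ?thesis
    unfolding fundamental_fun_def
    using norm_mono[OF indicator_L0 indicator_mem 1] norm_mono[OF indicator_L0 _ 2] by (simp add: antisym)
qed

end

section \<open>Equal cells of \<open>[0, 1)\<close> and their cyclic rotations\<close>

lemma abs_ereal_ge: "(x :: ereal) \<le> \<bar>x\<bar>"
  by (cases x) auto

text \<open>\<open>nat \<lfloor>real m * t\<rfloor>\<close> is the index of the cell of length
  \<open>1/m\<close> containing \<open>t\<close>, so the set is a disjoint union of the cells
  selected by \<open>P\<close>.\<close>

lemma emeasure_grid_cells:
  assumes "0 < m"
  shows "{t. 0 \<le> t \<and> t < 1 \<and> P (nat \<lfloor>real m * t\<rfloor>)} \<in> sets borel" (is "?A \<in> _")
    and "emeasure lebesgue {t. 0 \<le> t \<and> t < 1 \<and> P (nat \<lfloor>real m * t\<rfloor>)} =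
      ennreal (real (card {i \<in> {..<m}. P i}) / real m)"
proof -
  define J where "J i = {real i / real m..<(real i + 1) / real m}" for i
  have J_iff: "t \<in> J i \<longleftrightarrow> 0 \<le> t \<and> nat \<lfloor>real m * t\<rfloor> = i" for t i
  proof -
    have "t \<in> J i \<longleftrightarrow> real i \<le> real m * t \<and> real m * t < real i + 1"
      using assms unfolding J_def by (auto simp: field_simps)
    also have "\<dots> \<longleftrightarrow> \<lfloor>real m * t\<rfloor> = int i"
      by (simp add: floor_eq_iff)
    also have "\<dots> \<longleftrightarrow> 0 \<le> t \<and> nat \<lfloor>real m * t\<rfloor> = i"
    proof (cases "0 \<le> t")
      case True
      then have "0 \<le> \<lfloor>real m * t\<rfloor>" by simp
      then show ?thesis using True by (auto simp: eq_nat_nat_iff)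
    next
      \<comment> \<open>\<open>nat\<close> sends negative integers to 0, so without the condition
        \<open>0 \<le> t\<close> negative points would be counted in cell 0.\<close>
      case False
      then have "\<lfloor>real m * t\<rfloor> < 0" using assms by (simp add: floor_less_iff mult_pos_neg)
      then have "\<lfloor>real m * t\<rfloor> \<noteq> int i" by linarith
      then show ?thesis using False by simp
    qed
    finally show ?thesis .
  qed
  have lt: "t < 1 \<longleftrightarrow> nat \<lfloor>real m * t\<rfloor> < m" if "0 \<le> t" for t
  proof -
    have "nat \<lfloor>real m * t\<rfloor> < m \<longleftrightarrow> real m * t < real m"
      using that assms by (simp add: nat_less_iff floor_less_iff)
    then show ?thesis using assms by simp
  qed
  have A: "?A = (\<Union>i\<in>{i \<in> {..<m}. P i}. J i)"
    using lt by (auto simp: J_iff)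
  show "?A \<in> sets borel"
    unfolding A by (intro sets.finite_UN) (auto simp: J_def)
  have "emeasure lborel ?A = (\<Sum>i\<in>{i \<in> {..<m}. P i}. emeasure lborel (J i))"
    unfolding A by (rule sum_emeasure[symmetric]) (auto simp: J_def[symmetric] disjoint_family_on_def J_iff, simp add: J_def)
  also have "\<dots> = (\<Sum>i\<in>{i \<in> {..<m}. P i}. ennreal (1 / real m))"
    using assms by (intro sum.cong refl) (simp add: J_def diff_divide_distrib[symmetric] divide_right_mono)
  also have "\<dots> = ennreal (real (card {i \<in> {..<m}. P i}) / real m)"
    by (simp add: ennreal_of_nat_eq_real_of_nat ennreal_mult'[symmetric])
  finally show "emeasure lebesgue ?A = ennreal (real (card {i \<in> {..<m}. P i}) / real m)"
    using \<open>?A \<in> sets borel\<close> by simp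
qed

lemma bij_betw_add_mod: "bij_betw (\<lambda>i. (i + k) mod m) {..<m} {..<m :: nat}"
proof (cases "m = 0")
  case False
  have "inj_on (\<lambda>i. (i + k) mod m) {..<m}"
  proof (rule inj_onI)
    fix i j assume ij: "i \<in> {..<m}" "j \<in> {..<m}" "(i + k) mod m = (j + k) mod m"
    then have "int m dvd (int i + int k) - (int j + int k)"
      by (metis mod_eq_dvd_iff of_nat_add of_nat_mod)
    then have "int m dvd int i - int j" by simp
    then show "i = j"
      using ij(1,2) by (metis lessThan_iff mod_eq_dvd_iff mod_less of_nat_eq_iff of_nat_mod)
  qed
  moreover have "(\<lambda>i. (i + k) mod m) ` {..<m} \<subseteq> {..<m}"
    using False by auto
  ultimately show ?thesis
    by (simp add: bij_betw_def endo_inj_surj)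
qed (simp add: bij_betw_def)

context symmetric_space_ge1
begin

text \<open>All cyclic rotations of a step function on \<open>m\<close> cells of \<open>[0, 1)\<close> have the same norm, and
  their sum is constant.\<close>
lemma step_function_mean_le:
  fixes a :: "nat \<Rightarrow> real"
  assumes m: "0 < m" and a: "\<And>i. 0 \<le> a i" and g: "g \<in> E"
    and le: "\<And>t. 0 \<le> t \<Longrightarrow> t < 1 \<Longrightarrow> ereal (a (nat \<lfloor>real m * t\<rfloor>)) \<le> g t"
  shows "(\<Sum>i<m. a i) / real m * N (indicator {0..<1}) \<le> N g"
proof -
  \<comment> \<open>\<open>S k\<close> is the step function with values \<open>a i\<close>, rotated
    by \<open>k\<close> cells.\<close>
  define S where "S k t = (if 0 \<le> t \<and> t < 1 then ereal (a ((nat \<lfloor>real m * t\<rfloor> + k) mod m)) else 0)" for k and t :: real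
  have cell: "nat \<lfloor>real m * t\<rfloor> < m" if "0 \<le> t" "t < 1" for t
    using that m by (simp add: nat_less_iff floor_less_iff)
  have SL: "S k \<in> L0 \<alpha>" for k
    unfolding S_def by (intro borel_imp_L0) measurable
  have set_eq: "{s \<in> dom_I \<alpha>. ereal r < \<bar>S k s\<bar>} = {t. 0 \<le> t \<and> t < 1 \<and> r < a ((nat \<lfloor>real m * t\<rfloor> + k) mod m)}"
    if "0 \<le> r" for r k
    using that a mem_dom_I by (auto simp: S_def zero_ereal_def split: if_splits)
  have dist: "dist_fun \<alpha> (S k) = dist_fun \<alpha> (S 0)" for k
  proof
    fix r
    show "dist_fun \<alpha> (S k) r = dist_fun \<alpha> (S 0) r"
    proof (cases "0 \<le> r")
      case True
      have *: "dist_fun \<alpha> (S j) r = ennreal (real (card {i \<in> {..<m}. r < a ((i + j) mod m)}) / real m)" for j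
      proof -
        have "dist_fun \<alpha> (S j) r = emeasure lebesgue {t. 0 \<le> t \<and> t < 1 \<and> r < a ((nat \<lfloor>real m * t\<rfloor> + j) mod m)}"
          unfolding dist_fun_def set_eq[OF True]
          by (rule emeasure_leb_I)
            (use emeasure_grid_cells(1)[OF m, of "\<lambda>i. r < a ((i + j) mod m)"] mem_dom_I in auto)
        then show ?thesis
          by (simp only: emeasure_grid_cells(2)[OF m, of "\<lambda>i. r < a ((i + j) mod m)"])
      qed
      have "bij_betw (\<lambda>i. (i + k) mod m) {i \<in> {..<m}. r < a ((i + k) mod m)} {i \<in> {..<m}. r < a i}"
      proof (rule bij_betw_subset[OF bij_betw_add_mod])
        have "\<exists>i<m. j = (i + k) mod m" if "j < m" for j
          using that bij_betw_imp_surj_on[OF bij_betw_add_mod[of k m]] by blast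
        then show "(\<lambda>i. (i + k) mod m) ` {i \<in> {..<m}. r < a ((i + k) mod m)} = {i \<in> {..<m}. r < a i}"
          using m by (fastforce simp: image_iff)
      qed auto
      then have "card {i \<in> {..<m}. r < a ((i + k) mod m)} = card {i \<in> {..<m}. r < a i}"
        by (rule bij_betw_same_card)
      moreover have "{i \<in> {..<m}. r < a ((i + 0) mod m)} = {i \<in> {..<m}. r < a i}"
        by auto
      ultimately show ?thesis
        by (simp only: *)
    qed (simp add: dist_fun_neg)
  qed
  have S0: "AE s in leb_I \<alpha>. \<bar>S 0 s\<bar> \<le> \<bar>g s\<bar>"
  proof (intro AE_I2)
    fix s
    show "\<bar>S 0 s\<bar> \<le> \<bar>g s\<bar>"
    proof (cases "0 \<le> s \<and> s < 1")
      case True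
      then have "0 \<le> ereal (a (nat \<lfloor>real m * s\<rfloor>))" "ereal (a (nat \<lfloor>real m * s\<rfloor>)) \<le> g s"
        using a le by auto
      then show ?thesis
        using True cell order_trans[OF _ abs_ereal_ge] by (simp add: S_def)
    next
      case False
      then have "S 0 s = 0" by (auto simp: S_def)
      then show ?thesis by simp
    qed
  qed
  have SE: "S k \<in> E" "N (S k) \<le> N g" for k
    using symmetric[OF SL mem_mono[OF SL g S0] dist[of k]] norm_mono[OF SL g S0] by auto
  let ?c = "\<Sum>i<m. a i"
  have "N (\<lambda>s. ereal ?c * indicator {0..<1} s) \<le> N (\<lambda>s. \<Sum>k<m. S k s)"
  proof (rule norm_mono)
    show "(\<lambda>s. ereal ?c * indicator {0..<1} s) \<in> L0 \<alpha>"
      by (intro mem_L0 scale_mem indicator_mem)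
    show "(\<lambda>s. \<Sum>k<m. S k s) \<in> E"
      using sum_mem_norm[of "{..<m}" S] SE by simp
    have "ereal ?c * indicator {0..<1} s = (\<Sum>k<m. S k s)" for s
    proof (cases "0 \<le> s \<and> s < 1")
      case True
      \<comment> \<open>At a fixed point the \<open>m\<close> rotations run through every value of
        \<open>a\<close> exactly once.\<close>
      have "(\<Sum>k<m. a ((nat \<lfloor>real m * s\<rfloor> + k) mod m)) = (\<Sum>i<m. a i)"
        using sum.reindex_bij_betw[OF bij_betw_add_mod[of "nat \<lfloor>real m * s\<rfloor>" m], of a] by (simp add: add.commute)
      then show ?thesis using True by (simp add: S_def indicator_def)
    next
      case False
      then have "S k s = 0" for k by (auto simp: S_def)
      then show ?thesis using False by (auto simp: indicator_def)
    qed
    then show "AE s in leb_I \<alpha>. \<bar>ereal ?c * indicator {0..<1} s\<bar> \<le> \<bar>\<Sum>k<m. S k s\<bar>"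
      by simp
  qed
  also have "\<dots> \<le> (\<Sum>k<m. N (S k))"
    using sum_mem_norm[of "{..<m}" S] SE by simp
  also have "\<dots> \<le> real m * N g"
    using sum_mono[of "{..<m}" "\<lambda>k. N (S k)" "\<lambda>k. N g"] SE by simp
  finally have "?c * N (indicator {0..<1}) \<le> real m * N g"
    using norm_scale[OF indicator_mem, of ?c 1] sum_nonneg[of "{..<m}" a] a by simp
  then show ?thesis using m by (simp add: field_simps)
qed

text \<open>The mean inequality is applied to the step function taking on each cell the value of
  \<open>?f\<close> at the right end. Shifted by one cell, the same values dominate
  \<open>?f\<close> on \<open>[1/m, 1)\<close>, so the same mean bounds the integral there. Monotone
  convergence then reaches \<open>(0, 1)\<close>.\<close>

lemma nn_integral_rearr_le:
  assumes x: "x \<in> E"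
  shows "(\<integral>\<^sup>+ t. e2ennreal (rearr \<alpha> x t) * indicator {0<..<1} t \<partial>lborel)
    \<le> ennreal (N x / N (indicator {0..<1}))"
proof -
  let ?f = "rearr \<alpha> x"
  have [measurable]: "?f \<in> borel_measurable borel"
    by (rule rearr_borel[OF mem_L0[OF x]])
  define b where "b t = real_of_ereal (?f t)" for t
  have b: "ereal (b t) = ?f t" if "0 < t" for t
    using rearr_finite[OF x that] by (simp add: b_def ereal_real)
  have b0: "0 \<le> b t" for t
    by (simp add: b_def real_of_ereal_pos)
  have "(\<integral>\<^sup>+ t. e2ennreal (?f t) * indicator {1 / real (Suc n)..<1} t \<partial>lborel)
    \<le> ennreal (N x / N (indicator {0..<1}))" for n
  proof -
    let ?m = "Suc n"
    define a where "a i = b (real (Suc i) / real ?m)" for i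
    have a0: "0 \<le> a i" for i by (simp add: a_def b0)
    have "ereal (a (nat \<lfloor>real ?m * t\<rfloor>)) \<le> ?f t" if "0 \<le> t" "t < 1" for t
    proof -
      have "real (nat \<lfloor>real ?m * t\<rfloor>) = of_int \<lfloor>real ?m * t\<rfloor>" using that by simp
      then have "real ?m * t \<le> real (Suc (nat \<lfloor>real ?m * t\<rfloor>))" by linarith
      then have "t \<le> real (Suc (nat \<lfloor>real ?m * t\<rfloor>)) / real ?m" by (simp add: field_simps)
      then show ?thesis unfolding a_def by (subst b) (auto intro: rearr_antimono)
    qed
    then have mean: "(\<Sum>i<?m. a i) / real ?m * N (indicator {0..<1}) \<le> N x"
      using step_function_mean_le[of ?m a ?f] a0 rearr_mem[OF x] norm_rearr[OF x] by auto
    \<comment> \<open>\<open>J i\<close> is cell \<open>i + 1\<close>, with left end at the point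
      where \<open>a i\<close> is sampled. The last one lies beyond 1, which only enlarges the upper
      bound.\<close>
    define J where "J i = {real (Suc i) / real ?m..<real (Suc (Suc i)) / real ?m}" for i
    have "e2ennreal (?f t) * indicator {1 / real ?m..<1} t \<le> (\<Sum>i<?m. ennreal (a i) * indicator (J i) t)" for t
    proof (cases "t \<in> {1 / real ?m..<1}")
      case True
      \<comment> \<open>The floor is at least 1 because \<open>t \<ge> 1/m\<close>, so the
        natural-number subtraction does not truncate.\<close>
      define i where "i = nat \<lfloor>real ?m * t\<rfloor> - 1"
      have t1: "1 \<le> real ?m * t" "t < 1" using True by (auto simp: field_simps)
      have fl: "1 \<le> \<lfloor>real ?m * t\<rfloor>" using t1 by (simp add: le_floor_iff)
      have i: "real (Suc i) = of_int \<lfloor>real ?m * t\<rfloor>"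
        unfolding i_def using fl by (simp add: of_nat_diff nat_le_eq_zle)
      have "real (Suc i) \<le> real ?m * t" "real ?m * t < real (Suc (Suc i))"
        using i by linarith+
      then have tJ: "t \<in> J i" "real (Suc i) / real ?m \<le> t"
        unfolding J_def by (auto simp: field_simps)
      have "real ?m * t < real ?m" using t1 by simp
      then have "real (Suc i) < real ?m"
        using \<open>real (Suc i) \<le> real ?m * t\<close> by linarith
      then have im: "i < ?m" by simp
      have "?f t \<le> ?f (real (Suc i) / real ?m)"
        by (rule rearr_antimono[OF tJ(2)])
      also have "\<dots> = ereal (a i)"
        unfolding a_def by (rule b[symmetric]) simp
      finally have "?f t \<le> ereal (a i)" .
      then have "e2ennreal (?f t) \<le> ennreal (a i)"
        using e2ennreal_mono by fastforce
      also have "\<dots> = ennreal (a i) * indicator (J i) t" using tJ by simp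
      also have "\<dots> \<le> (\<Sum>i<?m. ennreal (a i) * indicator (J i) t)"
        using im by (intro member_le_sum) auto
      finally show ?thesis using True by simp
    qed simp
    then have "(\<integral>\<^sup>+ t. e2ennreal (?f t) * indicator {1 / real ?m..<1} t \<partial>lborel)
      \<le> (\<integral>\<^sup>+ t. (\<Sum>i<?m. ennreal (a i) * indicator (J i) t) \<partial>lborel)"
      by (intro nn_integral_mono) simp
    also have "\<dots> = (\<Sum>i<?m. ennreal (a i) * emeasure lborel (J i))"
      by (subst nn_integral_sum) (auto simp: J_def nn_integral_cmult_indicator)
    also have "\<dots> = (\<Sum>i<?m. ennreal (a i / real ?m))"
    proof (intro sum.cong refl)
      fix i
      have "emeasure lborel (J i) = ennreal (1 / real ?m)"
        unfolding J_def by (subst emeasure_lborel_Ico) (auto simp: divide_right_mono diff_divide_distrib[symmetric])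
      then show "ennreal (a i) * emeasure lborel (J i) = ennreal (a i / real ?m)"
        using a0 by (simp add: ennreal_mult'[symmetric])
    qed
    also have "\<dots> = ennreal ((\<Sum>i<?m. a i) / real ?m)"
      using a0 by (subst sum_ennreal) (simp_all only: sum_divide_distrib divide_nonneg_nonneg of_nat_0_le_iff)
    also have "\<dots> \<le> ennreal (N x / N (indicator {0..<1}))"
      using mean norm_indicator_pos[of 1] by (intro ennreal_leI) (simp only: pos_le_divide_eq zero_less_one)
    finally show ?thesis .
  qed
  note bound = this
  have "(\<integral>\<^sup>+ t. e2ennreal (?f t) * indicator {0<..<1} t \<partial>lborel)
     = (\<integral>\<^sup>+ t. (SUP n. e2ennreal (?f t) * indicator {1 / real (Suc n)..<1} t) \<partial>lborel)"
  proof (intro nn_integral_cong antisym)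
    fix t
    show "(SUP n. e2ennreal (?f t) * indicator {1 / real (Suc n)..<1} t) \<le> e2ennreal (?f t) * indicator {0<..<1} t"
    proof (intro SUP_least mult_left_mono)
      fix n
      have "0 < 1 / real (Suc n)" by simp
      then have "{1 / real (Suc n)..<1} \<subseteq> {0<..<1}"
        by (intro subsetI) (metis atLeastLessThan_iff greaterThanLessThan_iff less_le_trans)
      then show "indicator {1 / real (Suc n)..<1} t \<le> (indicator {0<..<1} t :: ennreal)"
        by (auto simp: indicator_def)
    qed simp
    show "e2ennreal (?f t) * indicator {0<..<1} t \<le> (SUP n. e2ennreal (?f t) * indicator {1 / real (Suc n)..<1} t)"
    proof (cases "t \<in> {0<..<1}")
      case True
      then obtain n where "1 / real (Suc n) < t"
        using nat_approx_posE[of t] by auto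
      then show ?thesis
        using True by (intro SUP_upper2[of n]) auto
    qed simp
  qed
  also have "\<dots> = (SUP n. \<integral>\<^sup>+ t. e2ennreal (?f t) * indicator {1 / real (Suc n)..<1} t \<partial>lborel)"
  proof (rule nn_integral_monotone_convergence_SUP)
    show "incseq (\<lambda>n t. e2ennreal (?f t) * indicator {1 / real (Suc n)..<1} t)"
    proof (intro incseq_SucI le_funI mult_left_mono)
      fix n t
      have "1 / real (Suc (Suc n)) \<le> 1 / real (Suc n)" by (simp add: frac_le)
      then show "indicator {1 / real (Suc n)..<1} t \<le> (indicator {1 / real (Suc (Suc n))..<1} t :: ennreal)"
        by (auto simp: indicator_def)
    qed simp
  qed measurable
  also have "\<dots> \<le> ennreal (N x / N (indicator {0..<1}))"
    using bound by (intro SUP_least)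
  finally show ?thesis .
qed

text \<open>Cut \<open>x\<close> at the level \<open>c\<close> of its rearrangement at 1. The part
  above \<open>c\<close> lives on a set of measure at most 1, so its rearrangement is carried by
  \<open>(0, 1)\<close>, where that of \<open>x\<close> is integrable. The other part is bounded by
  \<open>c\<close>.\<close>

lemma mem_L1_plus_Linf:
  assumes x: "x \<in> E"
  shows "x \<in> L1_plus_Linf \<alpha>"
proof -
  have [measurable]: "x \<in> borel_measurable (leb_I \<alpha>)"
    using mem_L0[OF x] by (simp add: L0_def)
  define c where "c = real_of_ereal (rearr \<alpha> x 1)"
  have c: "rearr \<alpha> x 1 = ereal c" "0 \<le> c"
    using rearr_finite[OF x, of 1] by (auto simp: c_def ereal_real real_of_ereal_pos)
  define u where "u s = (if ereal c < \<bar>x s\<bar> then x s else 0)" for s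
  define v where "v s = (if ereal c < \<bar>x s\<bar> then 0 else x s)" for s
  have uL: "u \<in> L0 \<alpha>" and vL: "v \<in> L0 \<alpha>"
    unfolding u_def v_def L0_def by measurable
  have le: "\<bar>u s\<bar> \<le> \<bar>x s\<bar>" for s by (simp add: u_def)
  have d: "dist_fun \<alpha> u r \<le> ennreal t" if "1 \<le> t" "0 < r" for r t
  proof -
    have "dist_fun \<alpha> u r \<le> dist_fun \<alpha> x c"
      unfolding dist_fun_def using that
      by (intro emeasure_mono level_set_measurable[OF mem_L0[OF x]]) (auto simp: u_def zero_ereal_def)
    also have "\<dots> \<le> ennreal 1"
      using rearr_le_iff[OF mem_L0[OF x] c(2), of 1] c(1) by simp
    also have "\<dots> \<le> ennreal t" using that by (intro ennreal_leI)
    finally show ?thesis .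
  qed
  \<comment> \<open>\<open>u\<close> and its rearrangement are equimeasurable, so the layer-cake
    formula gives them equal integrals.\<close>
  have "(\<integral>\<^sup>+ s. e2ennreal \<bar>u s\<bar> \<partial>leb_I \<alpha>) = (\<integral>\<^sup>+ s. e2ennreal \<bar>rearr \<alpha> u s\<bar> \<partial>leb_I \<alpha>)"
    by (simp only: nn_integral_abs_eq_dist_fun[OF uL] nn_integral_abs_eq_dist_fun[OF rearr_L0[OF uL]] dist_fun_rearr[OF uL])
  also have "\<dots> \<le> (\<integral>\<^sup>+ s. e2ennreal (rearr \<alpha> x s) * indicator {0<..<1} s \<partial>leb_I \<alpha>)"
  proof (rule nn_integral_mono_AE)
    show "AE s in leb_I \<alpha>. e2ennreal \<bar>rearr \<alpha> u s\<bar> \<le> e2ennreal (rearr \<alpha> x s) * indicator {0<..<1} s"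
      using AE_leb_I_pos
    proof eventually_elim
      case (elim s)
      show ?case
      proof (cases "s < 1")
        case True
        then show ?thesis
          using elim rearr_mono[OF dist_fun_mono[OF mem_L0[OF x]], of u s] le by (simp add: e2ennreal_mono)
      next
        case False
        then have "rearr \<alpha> u s = 0" by (intro rearr_supp d) auto
        then show ?thesis by (simp add: e2ennreal_neg)
      qed
    qed
  qed
  also have "\<dots> \<le> (\<integral>\<^sup>+ s. e2ennreal (rearr \<alpha> x s) * indicator {0<..<1} s \<partial>lebesgue)"
    by (subst nn_integral_restrict_space) (auto simp: dom_I_lebesgue intro!: nn_integral_mono simp: indicator_def)
  also have "\<dots> = (\<integral>\<^sup>+ s. e2ennreal (rearr \<alpha> x s) * indicator {0<..<1} s \<partial>lborel)"
    using rearr_borel[OF mem_L0[OF x]] by (intro nn_integral_completion) measurable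
  also have "\<dots> \<le> ennreal (N x / N (indicator {0..<1}))"
    by (rule nn_integral_rearr_le[OF x])
  also have "\<dots> < \<infinity>" by simp
  finally have "(\<integral>\<^sup>+ s. e2ennreal \<bar>u s\<bar> \<partial>leb_I \<alpha>) < \<infinity>" .
  moreover have "AE s in leb_I \<alpha>. \<bar>v s\<bar> \<le> ereal c"
    using c(2) by (auto simp: v_def not_less)
  moreover have "AE s in leb_I \<alpha>. x s = u s + v s"
    by (simp add: u_def v_def)
  ultimately show ?thesis
    unfolding L1_plus_Linf_def using mem_L0[OF x] uL vL by blast
qed

end

section \<open>Order continuity at LLUKM points\<close>

context symmetric_space_ge1
begin

lemma diff_mem: "x \<in> E \<Longrightarrow> y \<in> E \<Longrightarrow> (\<lambda>s. x s - y s) \<in> E"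
  using add_mem[OF _ scale_mem[of y "-1"], of x] by (simp add: minus_ereal_def flip: uminus_ereal.simps one_ereal_def)

text \<open>Order continuity of \<open>x\<close> is expressed by the norms of these heads vanishing
  as \<delta> tends to 0, and of the tails below as \<open>T\<close> tends to \<infinity>.\<close>

definition rearr_head :: "(real \<Rightarrow> ereal) \<Rightarrow> real \<Rightarrow> real \<Rightarrow> ereal" where
  "rearr_head x \<delta> t = (if t < \<delta> then rearr \<alpha> x t else 0)"

definition rearr_tail :: "(real \<Rightarrow> ereal) \<Rightarrow> real \<Rightarrow> real \<Rightarrow> ereal" where
  "rearr_tail x T t = (if t < T then 0 else rearr \<alpha> x t)"

lemma rearr_head_mem:
  assumes "x \<in> E"
  shows "rearr_head x \<delta> \<in> E"
proof (rule mem_mono[OF _ rearr_mem[OF assms]])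
  have [measurable]: "rearr \<alpha> x \<in> borel_measurable borel"
    by (rule rearr_borel[OF mem_L0[OF assms]])
  show "rearr_head x \<delta> \<in> L0 \<alpha>"
    unfolding rearr_head_def by (intro borel_imp_L0) measurable
qed (simp add: rearr_head_def)

lemma rearr_tail_mem:
  assumes "x \<in> E"
  shows "rearr_tail x T \<in> E"
proof (rule mem_mono[OF _ rearr_mem[OF assms]])
  have [measurable]: "rearr \<alpha> x \<in> borel_measurable borel"
    by (rule rearr_borel[OF mem_L0[OF assms]])
  show "rearr_tail x T \<in> L0 \<alpha>"
    unfolding rearr_tail_def by (intro borel_imp_L0) measurable
qed (simp add: rearr_tail_def)

text \<open>The restriction of \<open>x\<close> to \<open>A\<close> has a rearrangement below that
  of \<open>x\<close> which vanishes from \<delta> on. The resulting bound is uniform in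
  \<open>A\<close>.\<close>

lemma norm_on_small_set:
  assumes x: "x \<in> E" and A: "A \<in> sets (leb_I \<alpha>)" "emeasure (leb_I \<alpha>) A \<le> ennreal \<delta>"
  shows "(\<lambda>s. if s \<in> A then x s else 0) \<in> E"
    and "N (\<lambda>s. if s \<in> A then x s else 0) \<le> N (rearr_head x \<delta>)"
proof -
  let ?z = "\<lambda>s. if s \<in> A then x s else 0"
  have [measurable]: "x \<in> borel_measurable (leb_I \<alpha>)"
    using mem_L0[OF x] by (simp add: L0_def)
  have zL: "?z \<in> L0 \<alpha>"
    unfolding L0_def using A(1) by measurable
  have "rearr \<alpha> ?z t \<le> \<bar>rearr_head x \<delta> t\<bar>" for t
  proof (cases "t < \<delta>")
    case True
    then show ?thesis
      using rearr_mono[OF dist_fun_mono[OF mem_L0[OF x]], of ?z t] by (simp add: rearr_head_def)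
  next
    case False
    have "dist_fun \<alpha> ?z r \<le> ennreal t" if "0 < r" for r
    proof -
      have "dist_fun \<alpha> ?z r \<le> emeasure (leb_I \<alpha>) A"
        unfolding dist_fun_def using that A(1) by (intro emeasure_mono) (auto simp: zero_ereal_def split: if_splits)
      also have "\<dots> \<le> ennreal t"
        using A(2) False by (meson ennreal_leI not_less order_trans)
      finally show ?thesis .
    qed
    then have "rearr \<alpha> ?z t = 0"
      by (rule rearr_supp)
    then show ?thesis by simp
  qed
  then show "?z \<in> E" "N ?z \<le> N (rearr_head x \<delta>)"
    using rearr_norm_mono[OF zL rearr_head_mem[OF x, of \<delta>] AE_I2] by auto
qed

text \<open>The rearrangement of the truncation is bounded by \<open>l\<close> and by that of
  \<open>x\<close>; the first bound is used before \<open>T\<close>, the second after. For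
  \<open>T\<close> with a small tail, a small \<open>l\<close> makes the norm small.\<close>

lemma norm_truncation:
  assumes x: "x \<in> E" and l: "0 < l"
  shows "(\<lambda>s. min \<bar>x s\<bar> (ereal l)) \<in> E"
    and "N (\<lambda>s. min \<bar>x s\<bar> (ereal l)) \<le> l * N (indicator {0..<T}) + N (rearr_tail x T)"
proof -
  let ?z = "\<lambda>s. min \<bar>x s\<bar> (ereal l)"
  let ?y = "\<lambda>t. ereal l * indicator {0..<T} t + rearr_tail x T t"
  have [measurable]: "x \<in> borel_measurable (leb_I \<alpha>)"
    using mem_L0[OF x] by (simp add: L0_def)
  have zL: "?z \<in> L0 \<alpha>"
    unfolding L0_def by measurable
  have abs_z: "\<bar>?z s\<bar> = ?z s" for s
    using l by (intro abs_ereal_ge0) simp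
  have y: "?y \<in> E"
    by (intro add_mem scale_mem indicator_mem rearr_tail_mem x)
  have "rearr \<alpha> ?z t \<le> \<bar>?y t\<bar>" if "0 < t" for t
  proof -
    have "rearr \<alpha> ?z t \<le> rearr \<alpha> x t"
      by (intro rearr_mono dist_fun_mono mem_L0[OF x]) (auto simp: abs_z)
    moreover have "rearr \<alpha> ?z t \<le> ereal l"
      using l by (subst rearr_le_iff[OF zL]) (auto simp: dist_fun_def abs_z)
    ultimately show ?thesis
      using that l by (auto simp: rearr_tail_def indicator_def)
  qed
  then have "AE t in leb_I \<alpha>. rearr \<alpha> ?z t \<le> \<bar>?y t\<bar>"
    by (rule AE_leb_I_of_pos)
  note * = rearr_norm_mono[OF zL y this]
  show "?z \<in> E" by (rule *(1))
  have "N ?y \<le> N (\<lambda>t. ereal l * indicator {0..<T} t) + N (rearr_tail x T)"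
    by (intro norm_triangle scale_mem indicator_mem rearr_tail_mem x)
  then show "N ?z \<le> l * N (indicator {0..<T}) + N (rearr_tail x T)"
    using *(2) norm_scale[OF indicator_mem, of l T] l by simp
qed

section \<open>Applying the LLUKM property to approximations of the rearrangement from below\<close>

lemma hlp_le_of_abs_le:
  assumes "x \<in> E" "y \<in> E" "\<And>t. rearr \<alpha> y t \<le> rearr \<alpha> x t"
  shows "hlp_le \<alpha> y x"
proof -
  have "max_rearr \<alpha> y t \<le> max_rearr \<alpha> x t" for t
    unfolding max_rearr_def
    by (rule mult_left_mono[OF nn_integral_mono[OF mult_right_mono[OF e2ennreal_mono[OF assms(3)]]]]) simp_all
  then show ?thesis
    using assms(1,2) by (simp add: hlp_le_def mem_L1_plus_Linf)
qed

text \<open>Fatou turns monotone convergence of \<open>Y n\<close> to the rearrangement of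
  \<open>x\<close> into convergence of the norms to \<open>N x\<close>, and \<open>Y n\<close>
  precedes \<open>x\<close> in the order \<open>hlp_le\<close>, so the LLUKM property
  applies.\<close>

lemma llukm_approx:
  assumes fatou: "fatou_property \<alpha> E N" and llukm: "llukm_point \<alpha> E N x"
    and YL: "\<And>n. Y n \<in> L0 \<alpha>" and Y0: "\<And>n t. 0 \<le> Y n t" and Yle: "\<And>n t. Y n t \<le> rearr \<alpha> x t"
    and conv: "AE t in leb_I \<alpha>. incseq (\<lambda>n. Y n t) \<and> (\<lambda>n. Y n t) \<longlonglongrightarrow> rearr \<alpha> x t"
  shows "\<And>n. Y n \<in> E" "(\<lambda>n. N (\<lambda>t. rearr \<alpha> x t - rearr \<alpha> (Y n) t)) \<longlonglongrightarrow> 0"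
proof -
  have x: "x \<in> E" using llukm by (simp add: llukm_point_def)
  have ae: "AE t in leb_I \<alpha>. \<bar>Y n t\<bar> \<le> \<bar>rearr \<alpha> x t\<bar>" for n
    using Y0 Yle by (simp add: abs_ereal_ge0)
  show YE: "Y n \<in> E" for n
    by (rule mem_mono[OF YL rearr_mem[OF x] ae])
  have "N (Y n) \<le> N x" for n
    using norm_mono[OF YL rearr_mem[OF x] ae] by (simp add: norm_rearr x)
  then have "bdd_above (range (\<lambda>n. N (Y n)))"
    by (intro bdd_aboveI2)
  moreover have "Y n \<in> pos_cone \<alpha> E" for n
    using YE Y0 by (simp add: pos_cone_def)
  ultimately have "(\<lambda>n. N (Y n)) \<longlonglongrightarrow> N (rearr \<alpha> x)"
    using fatou conv rearr_L0[OF mem_L0[OF x]] unfolding fatou_property_def by blast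
  then have "(\<lambda>n. N (Y n)) \<longlonglongrightarrow> N x"
    by (simp add: norm_rearr x)
  moreover have "hlp_le \<alpha> (Y n) x" for n
  proof (rule hlp_le_of_abs_le[OF x YE])
    fix t
    have "dist_fun \<alpha> (Y n) r \<le> dist_fun \<alpha> x r" for r
      using dist_fun_mono[OF rearr_L0[OF mem_L0[OF x]] ae] by (simp add: dist_fun_rearr mem_L0 x)
    then show "rearr \<alpha> (Y n) t \<le> rearr \<alpha> x t"
      by (intro rearr_mono)
  qed
  ultimately show "(\<lambda>n. N (\<lambda>t. rearr \<alpha> x t - rearr \<alpha> (Y n) t)) \<longlonglongrightarrow> 0"
    using llukm YE unfolding llukm_point_def by blast
qed

text \<open>The rearrangement of the head on \<open>[0, n)\<close> vanishes from \<open>n\<close>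
  on, so there its difference from that of \<open>x\<close> is the whole tail.\<close>

lemma norm_rearr_tail_tendsto_0:
  assumes fatou: "fatou_property \<alpha> E N" and llukm: "llukm_point \<alpha> E N x"
  shows "(\<lambda>n. N (rearr_tail x (real n))) \<longlonglongrightarrow> 0"
proof -
  have x: "x \<in> E" using llukm by (simp add: llukm_point_def)
  define Y where "Y n = rearr_head x (real n)" for n
  have Y: "Y n \<in> L0 \<alpha>" "0 \<le> Y n t" "Y n t \<le> rearr \<alpha> x t" for n t
    using mem_L0[OF rearr_head_mem[OF x]] by (auto simp: Y_def rearr_head_def)
  have "incseq (\<lambda>n. Y n t) \<and> (\<lambda>n. Y n t) \<longlonglongrightarrow> rearr \<alpha> x t" for t
  proof
    show "incseq (\<lambda>n. Y n t)"
      by (auto intro!: incseq_SucI simp: Y_def rearr_head_def)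
    have "\<forall>\<^sub>F n in sequentially. t < real n"
      using filterlim_real_sequentially by (simp add: filterlim_at_top_dense)
    then have "\<forall>\<^sub>F n in sequentially. Y n t = rearr \<alpha> x t"
      by eventually_elim (simp add: Y_def rearr_head_def)
    then show "(\<lambda>n. Y n t) \<longlonglongrightarrow> rearr \<alpha> x t"
      by (rule tendsto_eventually)
  qed
  then have conv: "AE t in leb_I \<alpha>. incseq (\<lambda>n. Y n t) \<and> (\<lambda>n. Y n t) \<longlonglongrightarrow> rearr \<alpha> x t"
    by simp
  note approx = llukm_approx[OF fatou llukm Y conv]
  show ?thesis
  proof (rule tendsto_sandwich[OF _ _ tendsto_const approx(2)])
    have "N (rearr_tail x (real n)) \<le> N (\<lambda>t. rearr \<alpha> x t - rearr \<alpha> (Y n) t)" for n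
    proof (intro norm_mono diff_mem rearr_mem x approx(1) mem_L0 rearr_tail_mem AE_I2)
      fix t
      show "\<bar>rearr_tail x (real n) t\<bar> \<le> \<bar>rearr \<alpha> x t - rearr \<alpha> (Y n) t\<bar>"
      proof (cases "t < real n")
        case False
        have "dist_fun \<alpha> (Y n) r \<le> ennreal t" if "0 < r" for r
        proof -
          have "dist_fun \<alpha> (Y n) r \<le> emeasure (leb_I \<alpha>) (dom_I \<alpha> \<inter> {0..real n})"
            unfolding dist_fun_def using that
            by (intro emeasure_mono)
              (auto simp: Y_def rearr_head_def zero_ereal_def dom_I_def[of \<alpha>] sets_restrict_space dom_I_lebesgue split: if_splits)
          also have "\<dots> = emeasure lebesgue (dom_I \<alpha> \<inter> {0..real n})"
            by (intro emeasure_leb_I) (auto simp: dom_I_lebesgue)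
          also have "\<dots> \<le> emeasure lebesgue {0..real n}"
            by (intro emeasure_mono) auto
          also have "\<dots> \<le> ennreal t"
            using False by (simp add: ennreal_leI)
          finally show ?thesis .
        qed
        then have "rearr \<alpha> (Y n) t = 0" by (rule rearr_supp)
        then show ?thesis by (simp add: rearr_tail_def)
      qed (simp add: rearr_tail_def)
    qed
    then show "\<forall>\<^sub>F n in sequentially. N (rearr_tail x (real n)) \<le> N (\<lambda>t. rearr \<alpha> x t - rearr \<alpha> (Y n) t)"
      by simp
  qed (simp add: norm_nonneg rearr_tail_mem x)
qed

text \<open>Truncating the rearrangement at its value \<open>c n\<close> at
  \<open>\<delta> n\<close> leaves a function at most \<open>c n\<close>. Hence the head exceeds the
  LLUKM difference by at most \<open>c n\<close> on \<open>[0, \<delta> n)\<close>, a term whose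
  norm is exactly the quantity assumed to tend to 0.\<close>

lemma norm_rearr_head_tendsto_0:
  assumes fatou: "fatou_property \<alpha> E N" and llukm: "llukm_point \<alpha> E N x"
    and lim: "((\<lambda>t. rearr \<alpha> x t * ereal (fundamental_fun N t)) \<longlongrightarrow> 0) (at_right 0)"
  shows "(\<lambda>n. N (rearr_head x (1 / real (Suc n)))) \<longlonglongrightarrow> 0"
proof -
  have x: "x \<in> E" using llukm by (simp add: llukm_point_def)
  define \<delta> where "\<delta> n = 1 / real (Suc n)" for n
  have \<delta>: "0 < \<delta> n" for n by (simp add: \<delta>_def)
  have \<delta>_dec: "\<delta> (Suc n) \<le> \<delta> n" for n by (simp add: \<delta>_def frac_le)
  have \<delta>_lim: "\<delta> \<longlonglongrightarrow> 0"
    unfolding \<delta>_def using LIMSEQ_inverse_real_of_nat by (simp add: inverse_eq_divide)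
  define c where "c n = real_of_ereal (rearr \<alpha> x (\<delta> n))" for n
  have c: "rearr \<alpha> x (\<delta> n) = ereal (c n)" "0 \<le> c n" for n
    using rearr_finite[OF x \<delta>] by (auto simp: c_def ereal_real real_of_ereal_pos)
  define Y where "Y n t = min (rearr \<alpha> x t) (ereal (c n))" for n t
  have [measurable]: "rearr \<alpha> x \<in> borel_measurable borel"
    by (rule rearr_borel[OF mem_L0[OF x]])
  have Y: "Y n \<in> L0 \<alpha>" "0 \<le> Y n t" "Y n t \<le> rearr \<alpha> x t" for n t
  proof -
    show "Y n \<in> L0 \<alpha>"
      unfolding Y_def by (intro borel_imp_L0) measurable
  qed (auto simp: Y_def c)
  have "incseq (\<lambda>n. Y n t) \<and> (\<lambda>n. Y n t) \<longlonglongrightarrow> rearr \<alpha> x t" if "0 < t" for t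
  proof
    show "incseq (\<lambda>n. Y n t)"
      unfolding Y_def c(1)[symmetric]
      by (intro incseq_SucI min.mono order_refl rearr_antimono \<delta>_dec)
    \<comment> \<open>Once \<open>\<delta> n < t\<close>, monotonicity of the rearrangement makes
      the truncation inactive at \<open>t\<close>.\<close>
    have "\<forall>\<^sub>F n in sequentially. \<delta> n < t"
      by (rule order_tendstoD(2)[OF \<delta>_lim that])
    then have "\<forall>\<^sub>F n in sequentially. Y n t = rearr \<alpha> x t"
      by eventually_elim (auto simp: Y_def c(1)[symmetric] min_def intro: antisym rearr_antimono)
    then show "(\<lambda>n. Y n t) \<longlonglongrightarrow> rearr \<alpha> x t"
      by (rule tendsto_eventually)
  qed
  then have conv: "AE t in leb_I \<alpha>. incseq (\<lambda>n. Y n t) \<and> (\<lambda>n. Y n t) \<longlonglongrightarrow> rearr \<alpha> x t"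
    by (rule AE_leb_I_of_pos)
  note approx = llukm_approx[OF fatou llukm Y conv]
  have "((\<lambda>n. rearr \<alpha> x (\<delta> n) * ereal (fundamental_fun N (\<delta> n))) \<longlongrightarrow> 0) sequentially"
  proof (rule filterlim_compose[OF lim])
    show "filterlim \<delta> (at_right 0) sequentially"
      using \<delta>_lim \<delta> by (intro tendsto_imp_filterlim_at_right always_eventually) auto
  qed
  then have small: "(\<lambda>n. c n * N (indicator {0..<\<delta> n})) \<longlonglongrightarrow> 0"
    by (simp add: c(1) fundamental_fun_eq zero_ereal_def)
  have "(\<lambda>n. N (rearr_head x (\<delta> n))) \<longlonglongrightarrow> 0"
  proof (rule tendsto_sandwich[OF _ _ tendsto_const tendsto_add_zero[OF approx(2) small]])
    have "N (rearr_head x (\<delta> n))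
      \<le> N (\<lambda>t. rearr \<alpha> x t - rearr \<alpha> (Y n) t) + N (\<lambda>t. ereal (c n) * indicator {0..<\<delta> n} t)" for n
    proof (intro dominated_by_sum(2) diff_mem rearr_mem x approx(1) mem_L0 rearr_head_mem scale_mem indicator_mem)
      have abs_Y: "\<bar>Y n s\<bar> = Y n s" for s
        using Y(2) by (rule abs_ereal_ge0)
      have Y_bound: "rearr \<alpha> (Y n) t \<le> ereal (c n)" for t
      proof -
        have empty: "{s \<in> dom_I \<alpha>. ereal (c n) < \<bar>Y n s\<bar>} = {}"
          unfolding abs_Y by (simp add: Y_def)
        show ?thesis
          unfolding rearr_le_iff[OF Y(1) c(2)] dist_fun_def empty by simp
      qed
      have "\<bar>rearr_head x (\<delta> n) t\<bar> \<le> \<bar>rearr \<alpha> x t - rearr \<alpha> (Y n) t\<bar> + \<bar>ereal (c n) * indicator {0..<\<delta> n} t\<bar>"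
        if "0 < t" for t
        using c(2)[of n] that Y_bound[of t] rearr_nonneg[of \<alpha> "Y n" t]
        by (cases "rearr \<alpha> x t"; cases "rearr \<alpha> (Y n) t") (auto simp: rearr_head_def)
      then show "AE t in leb_I \<alpha>. \<bar>rearr_head x (\<delta> n) t\<bar>
          \<le> \<bar>rearr \<alpha> x t - rearr \<alpha> (Y n) t\<bar> + \<bar>ereal (c n) * indicator {0..<\<delta> n} t\<bar>"
        by (rule AE_leb_I_of_pos)
    qed
    then show "\<forall>\<^sub>F n in sequentially. N (rearr_head x (\<delta> n))
      \<le> N (\<lambda>t. rearr \<alpha> x t - rearr \<alpha> (Y n) t) + c n * N (indicator {0..<\<delta> n})"
      using norm_scale[OF indicator_mem] c(2) by simp
  qed (simp add: norm_nonneg rearr_head_mem x)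
  then show ?thesis by (simp add: \<delta>_def)
qed

end

section \<open>Convergence in measure and in norm\<close>

context symmetric_space_ge1
begin

text \<open>If the level set had infinite measure, the rearrangement would exceed \<open>a\<close>
  everywhere. Every tail would then dominate \<open>a\<close> times the indicator of a unit
  interval, and its norm could not tend to 0.\<close>

lemma dist_fun_finite:
  assumes x: "x \<in> E" and tail: "(\<lambda>n. N (rearr_tail x (real n))) \<longlonglongrightarrow> 0" and a: "0 < a"
  shows "dist_fun \<alpha> x a < \<infinity>"
proof (rule ccontr)
  assume "\<not> ?thesis"
  then have inf: "dist_fun \<alpha> x a = \<infinity>" by (metis infinity_ennreal_def top.not_eq_extremum)
  then have "\<alpha> = \<infinity>"
    using dist_fun_le[of \<alpha> x a] by (cases \<alpha>) (auto simp: top_unique e2ennreal_neg)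
  then have sub: "{real n..<real n + 1} \<subseteq> dom_I \<alpha>" for n
    by (auto simp: dom_I_def)
  have "0 < a * N (indicator {0..<1})"
    using a norm_indicator_pos[of 1] by simp
  then have "\<forall>\<^sub>F n in sequentially. N (rearr_tail x (real n)) < a * N (indicator {0..<1})"
    by (rule order_tendstoD(2)[OF tail])
  then obtain n where n: "N (rearr_tail x (real n)) < a * N (indicator {0..<1})"
    using eventually_happens trivial_limit_sequentially by blast
  let ?J = "{real n..<real n + 1}"
  have J: "(indicator ?J :: real \<Rightarrow> ereal) \<in> E"
    by (rule mem_mono[OF indicator_L0 indicator_mem[of "real n + 1"]]) (auto simp: indicator_def)
  have "N (indicator {0..<1}) \<le> N (indicator ?J)"
    using norm_indicator_ge(2)[OF _ sub J, of 1] by simp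
  then have "a * N (indicator {0..<1}) \<le> N (\<lambda>s. ereal a * indicator ?J s)"
    using norm_scale[OF J, of a] a by simp
  also have "\<dots> \<le> N (rearr_tail x (real n))"
  proof (intro norm_mono mem_L0 scale_mem J rearr_tail_mem x AE_I2)
    fix s
    have "ereal a < rearr \<alpha> x s"
      using less_rearr_iff[OF mem_L0[OF x], of a s] a inf by simp
    then show "\<bar>ereal a * indicator ?J s\<bar> \<le> \<bar>rearr_tail x (real n) s\<bar>"
      using a by (auto simp: rearr_tail_def indicator_def)
  qed
  finally show False using n by simp
qed

text \<open>Right-continuity of the distribution function turns a drop of the distribution function
  at level \<open>a\<close> into a gap of fixed height between the rearrangements on an interval of fixed length.\<close>
lemma level_set_difference_small:
  assumes x: "x \<in> E" and X: "\<And>n. X n \<in> E" "\<And>n. AE s in leb_I \<alpha>. \<bar>X n s\<bar> \<le> \<bar>x s\<bar>"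
    and fin: "dist_fun \<alpha> x a < \<infinity>" and a: "0 < a"
    and conv: "(\<lambda>n. N (\<lambda>t. rearr \<alpha> x t - rearr \<alpha> (X n) t)) \<longlonglongrightarrow> 0"
    and \<eta>: "0 < \<eta>"
  shows "\<forall>\<^sub>F n in sequentially.
    emeasure (leb_I \<alpha>) {s \<in> dom_I \<alpha>. ereal a < \<bar>x s\<bar> \<and> \<bar>X n s\<bar> \<le> ereal a} \<le> ennreal \<eta>"
proof (cases "dist_fun \<alpha> x a \<le> ennreal \<eta>")
  case True
  have "emeasure (leb_I \<alpha>) {s \<in> dom_I \<alpha>. ereal a < \<bar>x s\<bar> \<and> \<bar>X n s\<bar> \<le> ereal a} \<le> dist_fun \<alpha> x a" for n
    unfolding dist_fun_def by (intro emeasure_mono level_set_measurable mem_L0 x) auto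
  then show ?thesis
    using True by (intro always_eventually allI) (rule order_trans)
next
  case False
  obtain D where D: "dist_fun \<alpha> x a = ennreal D" "\<eta> < D"
    using fin False by (cases "dist_fun \<alpha> x a") (auto simp: ennreal_le_iff2 not_le)
  have "ennreal (D - \<eta> / 2) < dist_fun \<alpha> x a"
    using D \<eta> by (simp add: ennreal_less_iff)
  then obtain a' where a': "a < a'" "ennreal (D - \<eta> / 2) < dist_fun \<alpha> x a'"
    using dist_fun_right_continuous[OF mem_L0[OF x]] by blast
  \<comment> \<open>On \<open>?J\<close> the rearrangement of \<open>x\<close> exceeds
    \<open>a'\<close>. As \<open>\<eta> < D\<close>, the left end is positive and
    \<open>ennreal\<close> does not truncate it.\<close>
  let ?J = "{D - \<eta>..<D - \<eta> / 2}"
  have sub: "?J \<subseteq> dom_I \<alpha>"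
  proof
    fix t assume t: "t \<in> ?J"
    then have "ennreal t \<le> ennreal (D - \<eta> / 2)"
      by (intro ennreal_leI) simp
    then have "ennreal t < e2ennreal \<alpha>"
      using a'(2) dist_fun_le[of \<alpha> x a'] by auto
    moreover have "0 \<le> t" using t D by simp
    ultimately show "t \<in> dom_I \<alpha>"
      by (cases \<alpha>) (auto simp: dom_I_def ennreal_less_iff e2ennreal_neg)
  qed
  have J: "(indicator ?J :: real \<Rightarrow> ereal) \<in> E"
    using D by (intro mem_mono[OF indicator_L0 indicator_mem[of D]]) (auto simp: indicator_def)
  have J_norm: "N (indicator {0..<\<eta> / 2}) \<le> N (indicator ?J)"
    using \<eta> by (intro norm_indicator_ge(2)[OF _ sub J]) auto
  have "0 < (a' - a) * N (indicator {0..<\<eta> / 2})"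
    using a'(1) norm_indicator_pos[of "\<eta> / 2"] \<eta> by simp
  then have "\<forall>\<^sub>F n in sequentially.
      N (\<lambda>t. rearr \<alpha> x t - rearr \<alpha> (X n) t) < (a' - a) * N (indicator {0..<\<eta> / 2})"
    by (rule order_tendstoD(2)[OF conv])
  then show ?thesis
  proof eventually_elim
    case (elim n)
    let ?B = "{s \<in> dom_I \<alpha>. ereal a < \<bar>x s\<bar> \<and> \<bar>X n s\<bar> \<le> ereal a}"
    let ?U = "{s \<in> dom_I \<alpha>. ereal a < \<bar>x s\<bar>}" and ?V = "{s \<in> dom_I \<alpha>. ereal a < \<bar>X n s\<bar>}"
    have U: "?U \<in> sets (leb_I \<alpha>)" and V: "?V \<in> sets (leb_I \<alpha>)"
      by (intro level_set_measurable mem_L0 x X)+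
    have B_eq: "?B = ?U - ?V" by auto
    then have B: "?B \<in> sets (leb_I \<alpha>)" using U V by simp
    have "emeasure (leb_I \<alpha>) ?B + dist_fun \<alpha> (X n) a = emeasure (leb_I \<alpha>) (?B \<union> ?V)"
      unfolding dist_fun_def by (intro plus_emeasure B V) auto
    also have "\<dots> \<le> ennreal D"
      unfolding D(1)[symmetric] dist_fun_def
    proof (intro emeasure_mono_AE U)
      show "AE s in leb_I \<alpha>. s \<in> ?B \<union> ?V \<longrightarrow> s \<in> ?U"
        using X(2)[of n] by eventually_elim auto
    qed
    finally have sum: "emeasure (leb_I \<alpha>) ?B + dist_fun \<alpha> (X n) a \<le> ennreal D" .
    \<comment> \<open>Otherwise the rearrangement of \<open>X n\<close> is at most \<open>a\<close>
      on \<open>?J\<close>, and the difference of the rearrangements dominates \<open>a' - a\<close>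
      times the indicator of \<open>?J\<close>, contradicting the choice of
      \<open>n\<close>.\<close>
    have "ennreal (D - \<eta>) < dist_fun \<alpha> (X n) a"
    proof (rule ccontr)
      assume n: "\<not> ?thesis"
      have "(a' - a) * N (indicator {0..<\<eta> / 2}) \<le> (a' - a) * N (indicator ?J)"
        using a'(1) J_norm by (intro mult_left_mono) auto
      also have "\<dots> = N (\<lambda>s. ereal (a' - a) * indicator ?J s)"
        using norm_scale[OF J, of "a' - a"] a'(1) by simp
      also have "\<dots> \<le> N (\<lambda>t. rearr \<alpha> x t - rearr \<alpha> (X n) t)"
      proof (intro norm_mono mem_L0 scale_mem J diff_mem rearr_mem x X AE_I2)
        fix t
        show "\<bar>ereal (a' - a) * indicator ?J t\<bar> \<le> \<bar>rearr \<alpha> x t - rearr \<alpha> (X n) t\<bar>"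
        proof (cases "t \<in> ?J")
          case True
          then have "ennreal (D - \<eta>) \<le> ennreal t" "ennreal t \<le> ennreal (D - \<eta> / 2)"
            by (auto intro: ennreal_leI)
          then have "dist_fun \<alpha> (X n) a \<le> ennreal t" "ennreal t < dist_fun \<alpha> x a'"
            using n a'(2) by auto
          then have "rearr \<alpha> (X n) t \<le> ereal a" "ereal a' < rearr \<alpha> x t"
            using a a'(1) rearr_le_iff[OF mem_L0[OF X(1)[of n]], of a t] less_rearr_iff[OF mem_L0[OF x], of a' t]
            by auto
          then show ?thesis
            using True a'(1) rearr_nonneg[of \<alpha> "X n" t]
            by (cases "rearr \<alpha> x t"; cases "rearr \<alpha> (X n) t") auto
        qed simp
      qed
      finally show False using elim by simp
    qed
    then have "emeasure (leb_I \<alpha>) ?B + ennreal (D - \<eta>) \<le> ennreal D"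
      using sum by (meson add_left_mono less_imp_le order_trans)
    also have "\<dots> = ennreal \<eta> + ennreal (D - \<eta>)"
      using D \<eta> by (subst ennreal_plus[symmetric]) auto
    finally show "emeasure (leb_I \<alpha>) ?B \<le> ennreal \<eta>"
      by (simp add: add.commute[of _ "ennreal (D - \<eta>)"] ennreal_add_left_cancel_le)
  qed
qed

text \<open>A gap larger than \<open>l\<close> between \<open>\<bar>X n s\<bar>\<close> and
  \<open>\<bar>x s\<bar>\<close> contains a multiple of \<open>l\<close>. Off the small set where
  \<open>\<bar>x s\<bar>\<close> exceeds \<open>m l\<close>, only finitely many multiples matter,
  and each contributes a small set by \<open>level_set_difference_small\<close>.\<close>

lemma convergence_in_measure:
  assumes x: "x \<in> E" and X: "\<And>n. X n \<in> E" "\<And>n. AE s in leb_I \<alpha>. \<bar>X n s\<bar> \<le> \<bar>x s\<bar>"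
    and tail: "(\<lambda>n. N (rearr_tail x (real n))) \<longlonglongrightarrow> 0"
    and conv: "(\<lambda>n. N (\<lambda>t. rearr \<alpha> x t - rearr \<alpha> (X n) t)) \<longlonglongrightarrow> 0"
    and l: "0 < l" and \<eta>: "0 < \<eta>"
  shows "\<forall>\<^sub>F n in sequentially.
    emeasure (leb_I \<alpha>) {s \<in> dom_I \<alpha>. \<bar>X n s\<bar> + ereal l < \<bar>x s\<bar>} \<le> ennreal \<eta>"
proof -
  \<comment> \<open>By duality the level set of \<open>x\<close> at \<open>c\<close> has measure at
    most \<open>\<eta> / 2\<close>. The fewer than \<open>m\<close> levels below \<open>m l\<close>
    share the other half.\<close>
  define c where "c = real_of_ereal (rearr \<alpha> x (\<eta> / 2))"
  have c: "rearr \<alpha> x (\<eta> / 2) = ereal c" "0 \<le> c"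
    using rearr_finite[OF x, of "\<eta> / 2"] \<eta> by (auto simp: c_def ereal_real real_of_ereal_pos)
  obtain m where m: "c < real m * l"
    using reals_Archimedean3[OF l] by blast
  then have m0: "0 < m" using c(2) by (cases m) auto
  define K where "K = {s \<in> dom_I \<alpha>. ereal (real m * l) < \<bar>x s\<bar>}"
  define B where "B j n = {s \<in> dom_I \<alpha>. ereal (real j * l) < \<bar>x s\<bar> \<and> \<bar>X n s\<bar> \<le> ereal (real j * l)}" for j n
  have K_small: "emeasure (leb_I \<alpha>) K \<le> ennreal (\<eta> / 2)"
  proof -
    have "emeasure (leb_I \<alpha>) K \<le> dist_fun \<alpha> x c"
      unfolding K_def dist_fun_def[symmetric] using m by (intro dist_fun_antimono mem_L0 x) simp
    also have "\<dots> \<le> ennreal (\<eta> / 2)"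
      using rearr_le_iff[OF mem_L0[OF x] c(2), of "\<eta> / 2"] c(1) by simp
    finally show ?thesis .
  qed
  have "\<forall>j\<in>{1..<m}. \<forall>\<^sub>F n in sequentially. emeasure (leb_I \<alpha>) (B j n) \<le> ennreal (\<eta> / (2 * real m))"
    unfolding B_def using l \<eta> m0
    by (intro ballI level_set_difference_small x X conv dist_fun_finite tail) auto
  then have "\<forall>\<^sub>F n in sequentially. \<forall>j\<in>{1..<m}. emeasure (leb_I \<alpha>) (B j n) \<le> ennreal (\<eta> / (2 * real m))"
    by (intro eventually_ball_finite) auto
  then show ?thesis
  proof eventually_elim
    case (elim n)
    have K_meas: "K \<in> sets (leb_I \<alpha>)"
      unfolding K_def by (intro level_set_measurable mem_L0 x)
    have B_meas: "B j n \<in> sets (leb_I \<alpha>)" for j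
    proof -
      have "B j n = {s \<in> dom_I \<alpha>. ereal (real j * l) < \<bar>x s\<bar>} - {s \<in> dom_I \<alpha>. ereal (real j * l) < \<bar>X n s\<bar>}"
        unfolding B_def by auto
      then show ?thesis
        using level_set_measurable[OF mem_L0] x X(1) by simp
    qed
    have "{s \<in> dom_I \<alpha>. \<bar>X n s\<bar> + ereal l < \<bar>x s\<bar>} \<subseteq> K \<union> (\<Union>j\<in>{1..<m}. B j n)"
    proof
      fix s assume "s \<in> {s \<in> dom_I \<alpha>. \<bar>X n s\<bar> + ereal l < \<bar>x s\<bar>}"
      then have s: "s \<in> dom_I \<alpha>" "\<bar>X n s\<bar> + ereal l < \<bar>x s\<bar>" by auto
      show "s \<in> K \<union> (\<Union>j\<in>{1..<m}. B j n)"
      proof (cases "ereal (real m * l) < \<bar>x s\<bar>")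
        case True
        then show ?thesis using s by (simp add: K_def)
      next
        case False
        then obtain q where q: "\<bar>x s\<bar> = ereal q" "q \<le> real m * l"
          by (cases "\<bar>x s\<bar>") auto
        obtain p where p: "\<bar>X n s\<bar> = ereal p" "0 \<le> p"
          using s(2) q abs_ereal_pos[of "X n s"] by (cases "\<bar>X n s\<bar>") auto
        have pq: "p + l < q" using s(2) p q by simp
        \<comment> \<open>The largest integer with \<open>j l\<close> strictly below
          \<open>q\<close>; the ceiling minus one, rather than the floor, keeps this strict when
          \<open>q / l\<close> is an integer.\<close>
        define j where "j = nat (\<lceil>q / l\<rceil> - 1)"
        have "1 < q / l" using pq p l by (simp add: less_divide_eq)
        then have "2 \<le> \<lceil>q / l\<rceil>" by linarith
        then have j: "real j = of_int \<lceil>q / l\<rceil> - 1" "1 \<le> j"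
          unfolding j_def by linarith+
        have "real j < q / l" "q / l \<le> real j + 1"
          using j(1) by linarith+
        then have jq: "real j * l < q" "q \<le> real j * l + l"
          using l by (auto simp: field_simps)
        have "real j * l < real m * l"
          using jq(1) q(2) by (rule less_le_trans)
        then have "j < m" using l by simp
        moreover have "s \<in> B j n"
          using s(1) jq pq p q by (simp add: B_def)
        ultimately show ?thesis using j(2) by auto
      qed
    qed
    then have "emeasure (leb_I \<alpha>) {s \<in> dom_I \<alpha>. \<bar>X n s\<bar> + ereal l < \<bar>x s\<bar>}
        \<le> emeasure (leb_I \<alpha>) (K \<union> (\<Union>j\<in>{1..<m}. B j n))"
      using K_meas B_meas by (intro emeasure_mono sets.Un sets.finite_UN) auto
    also have "\<dots> \<le> emeasure (leb_I \<alpha>) K + emeasure (leb_I \<alpha>) (\<Union>j\<in>{1..<m}. B j n)"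
      using K_meas B_meas by (intro emeasure_subadditive sets.finite_UN) auto
    also have "\<dots> \<le> ennreal (\<eta> / 2) + (\<Sum>j\<in>{1..<m}. emeasure (leb_I \<alpha>) (B j n))"
      using B_meas by (intro add_mono K_small emeasure_subadditive_finite) auto
    also have "\<dots> \<le> ennreal (\<eta> / 2) + (\<Sum>j\<in>{1..<m}. ennreal (\<eta> / (2 * real m)))"
      using elim by (intro add_left_mono sum_mono) auto
    also have "\<dots> = ennreal (\<eta> / 2 + real (m - 1) * (\<eta> / (2 * real m)))"
      using \<eta> by (simp add: ennreal_of_nat_eq_real_of_nat ennreal_mult'[symmetric] ennreal_plus[symmetric] del: ennreal_plus)
    also have "\<dots> \<le> ennreal \<eta>"
      using m0 \<eta> by (intro ennreal_leI) (simp add: field_simps of_nat_diff)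
    finally show ?case .
  qed
qed

text \<open>Where \<open>\<bar>X n s\<bar> + l < \<bar>x s\<bar>\<close> the difference is bounded
  by \<open>\<bar>x s\<bar>\<close> on a set of small measure, giving a head. Elsewhere it is
  bounded by both \<open>l\<close> and \<open>\<bar>x s\<bar>\<close>, giving the truncation
  estimate.\<close>

lemma llukm_imp_llum:
  assumes fatou: "fatou_property \<alpha> E N" and llukm: "llukm_point \<alpha> E N x"
    and lim: "((\<lambda>t. rearr \<alpha> x t * ereal (fundamental_fun N t)) \<longlongrightarrow> 0) (at_right 0)"
  shows "llum_point \<alpha> E N (\<lambda>s. \<bar>x s\<bar>)"
  unfolding llum_point_def
proof (intro conjI allI impI)
  have x: "x \<in> E" using llukm by (simp add: llukm_point_def)
  note tail = norm_rearr_tail_tendsto_0[OF fatou llukm]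
  note head = norm_rearr_head_tendsto_0[OF fatou llukm lim]
  show "(\<lambda>s. \<bar>x s\<bar>) \<in> pos_cone \<alpha> E"
    using abs_mem[OF x] by (simp add: pos_cone_def)
  fix X
  assume X_pos: "\<forall>n. X n \<in> pos_cone \<alpha> E" and X_le: "\<forall>n. AE s in leb_I \<alpha>. X n s \<le> \<bar>x s\<bar>"
    and X_norm: "(\<lambda>n. N (X n)) \<longlonglongrightarrow> N (\<lambda>s. \<bar>x s\<bar>)"
  have X: "X n \<in> E" "AE s in leb_I \<alpha>. 0 \<le> X n s" for n
    using X_pos by (auto simp: pos_cone_def)
  have X_abs: "AE s in leb_I \<alpha>. \<bar>X n s\<bar> \<le> \<bar>x s\<bar>" for n
    using X(2)[of n] X_le[rule_format, of n] by eventually_elim simp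
  have "hlp_le \<alpha> (X n) x" for n
    by (intro hlp_le_of_abs_le x X rearr_mono dist_fun_mono mem_L0 X_abs)
  then have conv: "(\<lambda>n. N (\<lambda>t. rearr \<alpha> x t - rearr \<alpha> (X n) t)) \<longlonglongrightarrow> 0"
    using llukm X(1) X_norm unfolding llukm_point_def norm_abs[OF x] by blast
  have z: "(\<lambda>s. X n s - \<bar>x s\<bar>) \<in> E" for n
    by (intro diff_mem X abs_mem x)
  show "(\<lambda>n. N (\<lambda>s. X n s - \<bar>x s\<bar>)) \<longlonglongrightarrow> 0"
  proof (rule LIMSEQ_I)
    fix e :: real assume e: "0 < e"
    then have e3: "0 < e / 3" by simp
    obtain k where k: "N (rearr_tail x (real k)) < e / 3"
      using eventually_happens[OF order_tendstoD(2)[OF tail e3]] by auto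
    obtain m where m: "N (rearr_head x (1 / real (Suc m))) < e / 3"
      using eventually_happens[OF order_tendstoD(2)[OF head e3]] by auto
    define \<phi> where "\<phi> = N (indicator {0..<real k})"
    have \<phi>: "0 \<le> \<phi>" unfolding \<phi>_def by (intro norm_nonneg indicator_mem)
    \<comment> \<open>Depends on the tail index \<open>k\<close> chosen before. Adding 1 guards
      against \<phi> being 0, which happens for \<open>k = 0\<close>.\<close>
    define l where "l = e / (3 * (\<phi> + 1))"
    have l: "0 < l" "l * \<phi> \<le> e / 3"
      using e \<phi> by (auto simp: l_def field_simps)
    have "\<forall>\<^sub>F n in sequentially.
        emeasure (leb_I \<alpha>) {s \<in> dom_I \<alpha>. \<bar>X n s\<bar> + ereal l < \<bar>x s\<bar>} \<le> ennreal (1 / real (Suc m))"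
      by (intro convergence_in_measure x X X_abs tail conv l) simp
    then have "\<forall>\<^sub>F n in sequentially. norm (N (\<lambda>s. X n s - \<bar>x s\<bar>) - 0) < e"
    proof eventually_elim
      case (elim n)
      let ?A = "{s \<in> dom_I \<alpha>. \<bar>X n s\<bar> + ereal l < \<bar>x s\<bar>}"
      have [measurable]: "x \<in> borel_measurable (leb_I \<alpha>)" "X n \<in> borel_measurable (leb_I \<alpha>)"
        using mem_L0 x X(1) by (auto simp: L0_def)
      have "{s \<in> space (leb_I \<alpha>). \<bar>X n s\<bar> + ereal l < \<bar>x s\<bar>} \<in> sets (leb_I \<alpha>)"
        by measurable
      then have A: "?A \<in> sets (leb_I \<alpha>)" by simp
      note small = norm_on_small_set[OF x A elim]
      note trunc = norm_truncation(1)[OF x l(1)] norm_truncation(2)[OF x l(1), of "real k"]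
      have "N (\<lambda>s. X n s - \<bar>x s\<bar>) \<le> N (\<lambda>s. min \<bar>x s\<bar> (ereal l)) + N (\<lambda>s. if s \<in> ?A then x s else 0)"
      proof (rule dominated_by_sum(2)[OF mem_L0[OF z] trunc(1) small(1)])
        show "AE s in leb_I \<alpha>. \<bar>X n s - \<bar>x s\<bar>\<bar>
            \<le> \<bar>min \<bar>x s\<bar> (ereal l)\<bar> + \<bar>if s \<in> ?A then x s else 0\<bar>"
          using AE_space X(2)[of n] X_le[rule_format, of n] finite_ae[OF x]
        proof eventually_elim
          case (elim s)
          obtain q where q: "\<bar>x s\<bar> = ereal q" "0 \<le> q"
            using elim(4) abs_ereal_pos[of "x s"] by (cases "\<bar>x s\<bar>") auto
          obtain p where p: "X n s = ereal p" "0 \<le> p" "p \<le> q"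
            using elim(2,3) q by (cases "X n s") auto
          show ?case
            using elim(1) p q l(1) by (auto simp: min_def)
        qed
      qed
      also have "\<dots> \<le> (l * \<phi> + N (rearr_tail x (real k))) + N (rearr_head x (1 / real (Suc m)))"
        unfolding \<phi>_def by (intro add_mono trunc small)
      also have "\<dots> < e"
        using k m l(2) by simp
      finally show ?case
        using norm_nonneg[OF z[of n]] by simp
    qed
    then show "\<exists>no. \<forall>n\<ge>no. norm (N (\<lambda>s. X n s - \<bar>x s\<bar>) - 0) < e"
      by (simp add: eventually_sequentially)
  qed
qed

end

theorem theorem3p5:
  fixes \<alpha> :: ereal
    and E :: "(real \<Rightarrow> ereal) set"
    and N :: "(real \<Rightarrow> ereal) \<Rightarrow> real"
    and x :: "real \<Rightarrow> ereal"
  assumes "\<alpha> = 1 \<or> \<alpha> = \<infinity>"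
    and "symmetric_space \<alpha> E N"
    and "fatou_property \<alpha> E N"
    and "llukm_point \<alpha> E N x"
    and "((\<lambda>t. rearr \<alpha> x t * ereal (fundamental_fun N t)) \<longlongrightarrow> 0) (at_right 0)"
  shows "llum_point \<alpha> E N (\<lambda>s. \<bar>x s\<bar>)"
proof -
  interpret symmetric_space \<alpha> E N by fact
  interpret symmetric_space_ge1 \<alpha> E N
    by unfold_locales (use assms(1) in auto)
  show ?thesis
    using assms(3-5) by (rule llukm_imp_llum)
qed

end
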